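(* Let $d\in\mathbb{N}$ and let $\pi_a$ be a probability density on $\mathbb{R}^d$ with $\mathbb{E}[\|\mathbf A_1\|^2]^{1/2}=\left(\int_{\mathbb{R}^d}\|\boldsymbol\xi\|^2\pi_a(\boldsymbol\xi)\,d\boldsymbol\xi\right)^{1/2}<\infty$, where $\mathbf A_1$ denotes a random vector with density $\pi_a$. For any $M>0$, any $f\in\overline{\mathcal F}_b$ (the function class depending on $\pi_a$ defined in the context) and any $n\in\mathbb{N}$, there exists an $\mathbb{R}^n$-valued $\sigma(\mathbf A,\mathbf B)$-measurable random vector $\boldsymbol W$ such that the quantum random neural network $F_{\boldsymbol W}$ (defined in the context) satisfies $$\mathbb{E}\left[\sup_{\boldsymbol x\in[-M,M]^d}\left|F_{\boldsymbol W}(\boldsymbol x)-f(\boldsymbol x)\right|\right]\le\frac1{\sqrt n}\left(8\left\|\frac{\widehat f}{\pi_a}\right\|_\infty\left(\frac{\pi}{2^{3/2}}+2\pi M d^{1/2}\,\mathbb{E}[\|\mathbf A_1\|^2]^{1/2}\right)+\overline L_2[f]\right),$$ where $\overline L_2[f]:=\left(2\int_{\mathbb{R}^d}\frac{|\widehat f(\boldsymbol\xi)|^2}{\pi_a(\boldsymbol\xi)}\,d\boldsymbol\xi\right)^{1/2}$.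
   Context: Fourier transform: $\widehat f(\boldsymbol\xi)=\int_{\mathbb{R}^d}e^{-2\pi \mathrm{i}\,\boldsymbol y\cdot\boldsymbol\xi}f(\boldsymbol y)\,d\boldsymbol y$; $\|\cdot\|$ is the Euclidean norm. The class $\overline{\mathcal F}$ consists of all $f:\mathbb{R}^d\to\mathbb{R}$ that are continuous and Lebesgue-integrable, with $\widehat f\in L^1(\mathbb{R}^d)$, $|\widehat f|\ll\pi_a$ (the measure with Lebesgue density $|\widehat f|$ is absolutely continuous with respect to the measure with Lebesgue density $\pi_a$) and $\int_{\mathbb{R}^d}|\widehat f(\boldsymbol\xi)|^2/\pi_a(\boldsymbol\xi)\,d\boldsymbol\xi<\infty$ (with $0/0=0$). $\overline{\mathcal F}_b$ is the set of $f\in\overline{\mathcal F}$ for which $\widehat f/\pi_a$ is bounded, with supremum norm $\|\widehat f/\pi_a\|_\infty$. Random parameters: $\mathbf B=(B^i)_{i=1,\dots,n}$ are i.i.d. with $\mathbb{P}(B^i=0)=\mathbb{P}(B^i=1)=\frac12$; $\mathbf A=(\mathbf A^i)_{i=1,\dots,n}$ are i.i.d. $\mathbb{R}^d$-valued with density $\pi_a$, $\mathbf A^i=(A^i_1,\dots,A^i_d)$; $\mathbf A$ and $\mathbf B$ are independent; $\sigma(\mathbf A,\mathbf B)$ is the $\sigma$-algebra they generate. Random quantum circuit. With $\mathtt H=\frac1{\sqrt2}\begin{pmatrix}1&1\\1&-1\end{pmatrix}$ and $\mathtt R_z(\alpha)=\begin{pmatrix}e^{-\mathrm i\alpha/2}&0\\0&e^{\mathrm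 i\alpha/2}\end{pmatrix}$, for $\boldsymbol x\in\mathbb{R}^d$ and $i=1,\dots,n$ let $\overline{\mathtt U}_1^{(i)}(\boldsymbol x)=\mathtt H\,\mathtt R_z(-\tfrac\pi2B^i)\,\mathtt R_z(-2\pi A^i_dx_d)\cdots\mathtt R_z(-2\pi A^i_1x_1)\,\mathtt H$. Let $\overline n_0\ge0$ be the smallest integer with $\log_2(2n+\overline n_0)\in\mathbb{N}$, $\overline{\mathfrak n}=\lceil\log_2(2n)\rceil$, $\overline N=2n+\overline n_0=2^{\overline{\mathfrak n}}$, and let $\overline{\mathtt U}(\boldsymbol x)\in\mathbb{C}^{\overline N\times\overline N}$ be block-diagonal with diagonal blocks $\overline{\mathtt U}_1^{(1)}(\boldsymbol x),\dots,\overline{\mathtt U}_1^{(n)}(\boldsymbol x)$ and the $\overline n_0\times\overline n_0$ identity. Let $|0\rangle,\dots,|\overline N-1\rangle$ be the computational (standard) basis of $\mathbb{C}^{\overline N}$, $|0\rangle=|0\rangle^{\otimes\overline{\mathfrak n}}$, and let $\overline{\mathtt V}$ be any unitary matrix mapping $|0\rangle^{\otimes\overline{\mathfrak n}}$ to $\frac1{\sqrt n}\sum_{i=0}^{n-1}|2i\rangle$. Put $\overline{\mathbb P}_k(\boldsymbol x)=|\langle k|\overline{\mathtt U}(\boldsymbol x)\overline{\mathtt V}|0\rangle^{\otimes\overline{\mathfrak n}}|^2$ for $k=0,\dots,\overline N-1$ (the probability of measuring $k$; it depends on the realisation of $\mathbf A,\mathbf B$). For $\boldsymbol w=(w_0,\dots,w_{n-1})\in\mathbb{R}^n$,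 $$F_{\boldsymbol w}(\boldsymbol x)=\sum_{j=0}^{n-1}w_j\left(2\overline{\mathbb P}_{2j}(\boldsymbol x)-\frac1n\right).$$ *)

theory Defs
  imports "HOL-Probability.Probability" "Jordan_Normal_Form.Schur_Decomposition"
begin

(* The operators written with a dollar sign and a bullet are overloaded between HOL-Analysis and
   Jordan_Normal_Form, hence vec_nth and inner below.  Vectors in R^d are of type real^'d, where the
   linear order on the index type fixes the order of the coordinates 1, ..., d. *)

section \<open>Function classes\<close>

definition fourier :: "(real^'d \<Rightarrow> real) \<Rightarrow> real^'d \<Rightarrow> complex" where
  "fourier f \<xi> = (LINT y|lborel. exp (- 2 * of_real pi * \<i> * of_real (inner y \<xi>)) * of_real (f y))"

definition prob_density :: "(real^'d \<Rightarrow> real) \<Rightarrow> bool" where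
  "prob_density \<pi> \<longleftrightarrow> \<pi> \<in> borel_measurable borel \<and> (\<forall>\<xi>. 0 \<le> \<pi> \<xi>) \<and> (\<integral>\<^sup>+ \<xi>. ennreal (\<pi> \<xi>) \<partial>lborel) = 1"

(* Division by zero yields 0 here.  In class_F, absolute continuity makes {\<pi> = 0, fourier f \<noteq> 0}
   a null set, so for the integral only the convention 0/0 = 0 matters; on that null set the
   supremum norm below counts the quotient as 0. *)
definition class_F :: "(real^'d \<Rightarrow> real) \<Rightarrow> (real^'d \<Rightarrow> real) set" where
  "class_F \<pi> = {f. continuous_on UNIV f \<and> integrable lborel f \<and> integrable lborel (fourier f) \<and>
     absolutely_continuous (density lborel (\<lambda>\<xi>. ennreal (\<pi> \<xi>)))
       (density lborel (\<lambda>\<xi>. ennreal (cmod (fourier f \<xi>)))) \<and>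
     integrable lborel (\<lambda>\<xi>. (cmod (fourier f \<xi>))\<^sup>2 / \<pi> \<xi>)}"

definition class_Fb :: "(real^'d \<Rightarrow> real) \<Rightarrow> (real^'d \<Rightarrow> real) set" where
  "class_Fb \<pi> = {f \<in> class_F \<pi>. bounded (range (\<lambda>\<xi>. fourier f \<xi> / of_real (\<pi> \<xi>)))}"

definition ratio_sup_norm :: "(real^'d \<Rightarrow> real) \<Rightarrow> (real^'d \<Rightarrow> real) \<Rightarrow> real" where
  "ratio_sup_norm \<pi> f = (SUP \<xi>. cmod (fourier f \<xi> / of_real (\<pi> \<xi>)))"

definition L2bar :: "(real^'d \<Rightarrow> real) \<Rightarrow> (real^'d \<Rightarrow> real) \<Rightarrow> real" where
  "L2bar \<pi> f = sqrt (2 * (LINT \<xi>|lborel. (cmod (fourier f \<xi>))\<^sup>2 / \<pi> \<xi>))"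

section \<open>The circuit\<close>

definition Hgate :: "complex mat" where
  "Hgate = (1 / of_real (sqrt 2)) \<cdot>\<^sub>m mat_of_rows_list 2 [[1, 1], [1, -1]]"

definition Rz :: "real \<Rightarrow> complex mat" where
  "Rz \<alpha> = mat_of_rows_list 2
     [[exp (- \<i> * of_real \<alpha> / 2), 0], [0, exp (\<i> * of_real \<alpha> / 2)]]"

(* The fold multiplies from the left: Rz(-2 pi a_d x_d) * ... * Rz(-2 pi a_1 x_1). *)
definition U1 :: "real^'d::{finite,linorder} \<Rightarrow> real \<Rightarrow> real^'d::{finite,linorder} \<Rightarrow> complex mat" where
  "U1 a b x = Hgate * Rz (- pi / 2 * b) *
     fold (\<lambda>j Q. Rz (- 2 * pi * vec_nth a j * vec_nth x j) * Q) (sorted_list_of_set UNIV) (1\<^sub>m 2) *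
     Hgate"

definition n0bar :: "nat \<Rightarrow> nat" where
  "n0bar n = (LEAST m. log 2 (real (2 * n + m)) \<in> \<nat>)"

definition Nbar :: "nat \<Rightarrow> nat" where
  "Nbar n = 2 * n + n0bar n"

definition Ubar :: "nat \<Rightarrow> (nat \<Rightarrow> real^'d::{finite,linorder}) \<Rightarrow> (nat \<Rightarrow> real) \<Rightarrow> real^'d::{finite,linorder} \<Rightarrow> complex mat" where
  "Ubar n a b x = diag_block_mat (map (\<lambda>i. U1 (a i) (b i) x) [1..<n+1] @ [1\<^sub>m (n0bar n)])"

definition unitary_mat :: "nat \<Rightarrow> complex mat \<Rightarrow> bool" where
  "unitary_mat N V \<longleftrightarrow> V \<in> carrier_mat N N \<and> V * mat_adjoint V = 1\<^sub>m N \<and> mat_adjoint V * V = 1\<^sub>m N"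

definition is_Vbar :: "nat \<Rightarrow> complex mat \<Rightarrow> bool" where
  "is_Vbar n V \<longleftrightarrow> unitary_mat (Nbar n) V \<and>
     V *\<^sub>v unit_vec (Nbar n) 0 =
       (1 / of_real (sqrt (real n))) \<cdot>\<^sub>v
         finsum_vec TYPE(complex) (Nbar n) (\<lambda>i. unit_vec (Nbar n) (2 * i)) {..<n}"

definition Pbar :: "nat \<Rightarrow> complex mat \<Rightarrow> (nat \<Rightarrow> real^'d::{finite,linorder}) \<Rightarrow> (nat \<Rightarrow> real) \<Rightarrow>
    nat \<Rightarrow> real^'d::{finite,linorder} \<Rightarrow> real" where
  "Pbar n V a b k x =
     (cmod ((Ubar n a b x *\<^sub>v (V *\<^sub>v unit_vec (Nbar n) 0)) \<bullet>c unit_vec (Nbar n) k))\<^sup>2"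

definition qrnn :: "nat \<Rightarrow> complex mat \<Rightarrow> (nat \<Rightarrow> real^'d::{finite,linorder}) \<Rightarrow> (nat \<Rightarrow> real) \<Rightarrow>
    (nat \<Rightarrow> real) \<Rightarrow> real^'d::{finite,linorder} \<Rightarrow> real" where
  "qrnn n V a b w x = (\<Sum>j<n. w j * (2 * Pbar n V a b (2 * j) x - 1 / real n))"

(* ennreal-valued, so that the supremum and its expectation are meaningful without
   boundedness or integrability side conditions. *)
definition sup_error :: "nat \<Rightarrow> complex mat \<Rightarrow> (nat \<Rightarrow> real^'d::{finite,linorder}) \<Rightarrow> (nat \<Rightarrow> real) \<Rightarrow>
    (nat \<Rightarrow> real) \<Rightarrow> (real^'d::{finite,linorder} \<Rightarrow> real) \<Rightarrow> real \<Rightarrow> ennreal" where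
  "sup_error n V a b w f M =
     (SUP x\<in>{x. \<forall>j. vec_nth x j \<in> {-M..M}}. ennreal \<bar>qrnn n V a b w x - f x\<bar>)"

section \<open>Random parameters\<close>

definition family_of :: "nat \<Rightarrow> (nat \<Rightarrow> 'w \<Rightarrow> 'c) \<Rightarrow> 'w \<Rightarrow> nat \<Rightarrow> 'c" where
  "family_of n X \<omega> = (\<lambda>i\<in>{1..n}. X i \<omega>)"

definition sigma_AB :: "'w measure \<Rightarrow> nat \<Rightarrow> (nat \<Rightarrow> 'w \<Rightarrow> real^'d) \<Rightarrow> (nat \<Rightarrow> 'w \<Rightarrow> real) \<Rightarrow> 'w measure" where
  "sigma_AB P n A B = vimage_algebra (space P) (\<lambda>\<omega>. (family_of n A \<omega>, family_of n B \<omega>))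
     (PiM {1..n} (\<lambda>_. borel) \<Otimes>\<^sub>M PiM {1..n} (\<lambda>_. borel))"

(* The library's indep_var demands equal value types, so independence of A and B is stated for
   the sigma-algebras they generate. *)
definition random_params :: "'w measure \<Rightarrow> nat \<Rightarrow> (real^'d \<Rightarrow> real) \<Rightarrow>
    (nat \<Rightarrow> 'w \<Rightarrow> real^'d) \<Rightarrow> (nat \<Rightarrow> 'w \<Rightarrow> real) \<Rightarrow> bool" where
  "random_params P n \<pi> A B \<longleftrightarrow>
     (\<forall>i\<in>{1..n}. distributed P lborel (A i) (\<lambda>\<xi>. ennreal (\<pi> \<xi>))) \<and>
     prob_space.indep_vars P (\<lambda>_. borel) A {1..n} \<and>
     (\<forall>i\<in>{1..n}. measure P {\<omega> \<in> space P. B i \<omega> = 0} = 1/2 \<and> measure P {\<omega> \<in> space P. B i \<omega> = 1} = 1/2) \<and>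
     prob_space.indep_vars P (\<lambda>_. borel) B {1..n} \<and>
     prob_space.indep_set P
       (sets (vimage_algebra (space P) (family_of n A) (PiM {1..n} (\<lambda>_. borel))))
       (sets (vimage_algebra (space P) (family_of n B) (PiM {1..n} (\<lambda>_. borel))))"

end

(* Measuring the circuit turns it into the random cosine network
     F_w(x) = (1/n) sum_j w_j cos(2 pi A^j . x + (pi/2) B^j).
   With the weights 2 Re (fhat/pi_a)(A) for B = 0 and 2 Im (fhat/pi_a)(A) for B = 1, Fourier inversion
   makes each summand an unbiased estimator of f(x). The error is split at x = 0. The error at 0 is an
   average of n centred independent variables and gives the L2 term. The increments from 0 form a
   process dominated by the linear process x |-> 4 pi ||fhat/pi_a|| A . x; symmetrization, contraction
   and the square function of a random walk bound its supremum. Measuring increments of the cosine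
   against its own value at 0 leaves no contribution of B to the second part, so the summand
   pi / 2^(3/2) of the bound is slack. *)

theory Submission
  imports Defs
begin

section \<open>The circuit as a cosine network\<close>

text \<open>Two obstacles shape the proof: the supremum over the cube is uncountable, and
  symmetrization usually calls for a ghost sample and auxiliary random signs. Continuity replaces
  the cube by a dense sequence starting at the origin, so that a process becomes a random element of
  \<open>nat => real\<close>. A sum of independent copies is integrated one summand at a time, and a
  random sign occurs only as the average of two values inside \<open>sym_step\<close>. The induction
  closes because the properties used in one step survive that step; they are bundled in
  \<open>tame\<close>. The constant 16 pi = 8 * 2 pi is 2 * 2 pi * 2 * 2: weights are at most twice
  the supremum norm, phases have gradient 2 pi A, symmetrization doubles, and an absolute value is
  treated as two one-sided suprema. The factor M sqrt d is the radius of the cube. Inversion is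
  needed at every x, not just almost everywhere, since the error is measured in the supremum norm;
  Gaussian damping together with continuity of f provides this.\<close>

lemma Hgate_carrier [simp]: "Hgate \<in> carrier_mat 2 2"
  by (rule carrier_matI) (simp_all add: Hgate_def mat_of_rows_list_def)

lemma Rz_carrier [simp]: "Rz \<alpha> \<in> carrier_mat 2 2"
  by (rule carrier_matI) (simp_all add: Rz_def mat_of_rows_list_def)

lemma mat2_eqI:
  assumes "A \<in> carrier_mat 2 2" "B \<in> carrier_mat 2 2"
    and "A $$ (0,0) = B $$ (0,0)" "A $$ (0,1) = B $$ (0,1)"
    and "A $$ (1,0) = B $$ (1,0)" "A $$ (1,1) = B $$ (1,1)"
  shows "A = B"
proof (rule eq_matI)
  fix i j assume "i < dim_row B" "j < dim_col B"
  then have "i = 0 \<or> i = 1" "j = 0 \<or> j = 1" using assms(2) by auto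
  then show "A $$ (i,j) = B $$ (i,j)" using assms by auto
qed (use assms in auto)

lemma mat2_mult_index:
  assumes "A \<in> carrier_mat 2 2" "B \<in> carrier_mat 2 2" "i < 2" "j < 2"
  shows "(A * B) $$ (i,j) = A $$ (i,0) * B $$ (0,j) + A $$ (i,1) * B $$ (1,j)"
proof -
  have "(A * B) $$ (i,j) = (\<Sum>k<2. A $$ (i,k) * B $$ (k,j))"
    using assms by (auto simp: scalar_prod_def atLeast0LessThan intro!: sum.cong)
  then show ?thesis by (simp add: numeral_2_eq_2)
qed

lemma Rz_index:
  "Rz \<alpha> $$ (0,0) = exp (- \<i> * of_real \<alpha> / 2)" "Rz \<alpha> $$ (0,1) = 0"
  "Rz \<alpha> $$ (1,0) = 0" "Rz \<alpha> $$ (1,1) = exp (\<i> * of_real \<alpha> / 2)"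
  "Rz \<alpha> $$ (0,Suc 0) = 0"
  "Rz \<alpha> $$ (Suc 0,0) = 0" "Rz \<alpha> $$ (Suc 0,Suc 0) = exp (\<i> * of_real \<alpha> / 2)"
  by (simp_all add: Rz_def mat_of_rows_list_def)

lemma Hgate_index:
  "Hgate $$ (0,0) = 1 / of_real (sqrt 2)" "Hgate $$ (0,1) = 1 / of_real (sqrt 2)"
  "Hgate $$ (1,0) = 1 / of_real (sqrt 2)" "Hgate $$ (1,1) = - 1 / of_real (sqrt 2)"
  "Hgate $$ (0,Suc 0) = 1 / of_real (sqrt 2)"
  "Hgate $$ (Suc 0,0) = 1 / of_real (sqrt 2)"
  by (simp_all add: Hgate_def mat_of_rows_list_def)

lemma Rz_mult: "Rz \<alpha> * Rz \<beta> = Rz (\<alpha> + \<beta>)"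
proof (rule mat2_eqI)
  show "Rz \<alpha> * Rz \<beta> \<in> carrier_mat 2 2"
    by (rule mult_carrier_mat[of _ 2 2]) simp_all
qed (simp_all add: mat2_mult_index Rz_index mult_exp_exp distrib_left add_divide_distrib
    diff_divide_distrib)

lemma Rz_0: "Rz 0 = 1\<^sub>m 2"
  by (rule mat2_eqI) (simp_all add: Rz_index)

text \<open>The fold in the circuit starts at the identity, which is \<open>Rz 0\<close>; an
  arbitrary start \<open>Rz \<alpha>\<close> is what the induction over the accumulator
  requires.\<close>

lemma fold_Rz:
  "fold (\<lambda>j Q. Rz (g j) * Q) xs (Rz \<alpha>) = Rz (sum_list (map g xs) + \<alpha>)"
  by (induction xs arbitrary: \<alpha>) (simp_all add: Rz_mult algebra_simps)

text \<open>All rotations are about the same axis, so their angles add up and the order of the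
  factors is immaterial.\<close>

lemma U1_eq:
  "U1 a b x = Hgate * Rz (- (2 * pi * inner a x + pi / 2 * b)) * Hgate"
proof -
  have "(\<Sum>j\<leftarrow>sorted_list_of_set UNIV. - 2 * pi * vec_nth a j * vec_nth x j)
      = (\<Sum>j\<in>UNIV. - 2 * pi * vec_nth a j * vec_nth x j)"
    by (subst sum_list_distinct_conv_sum_set) auto
  also have "\<dots> = - (2 * pi * inner a x)"
    by (simp add: inner_vec_def sum_distrib_left sum_negf mult.assoc)
  finally have "fold (\<lambda>j Q. Rz (- 2 * pi * vec_nth a j * vec_nth x j) * Q)
      (sorted_list_of_set UNIV) (1\<^sub>m 2) = Rz (- (2 * pi * inner a x))"
    using fold_Rz[of "\<lambda>j. - 2 * pi * vec_nth a j * vec_nth x j" "sorted_list_of_set UNIV" 0]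
    by (simp add: Rz_0)
  then have "U1 a b x = Hgate * Rz (- pi / 2 * b) * Rz (- (2 * pi * inner a x)) * Hgate"
    by (simp add: U1_def)
  also have "Hgate * Rz (- pi / 2 * b) * Rz (- (2 * pi * inner a x))
      = Hgate * (Rz (- pi / 2 * b) * Rz (- (2 * pi * inner a x)))"
    by (rule assoc_mult_mat[of _ 2 2 _ 2 _ 2]) auto
  finally show ?thesis by (simp add: Rz_mult algebra_simps)
qed

lemma U1_carrier [simp]: "U1 a b x \<in> carrier_mat 2 2"
  unfolding U1_eq by (intro mult_carrier_mat[of _ 2 2]) simp_all

text \<open>The Hadamard gates on both sides average the two diagonal phases exp(it) and exp(-it),
  and the average is cos t. Here t is half of the total angle because \<open>Rz\<close> carries half
  of its argument in each phase.\<close>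

lemma U1_00: "U1 a b x $$ (0,0) = of_real (cos ((2 * pi * inner a x + pi / 2 * b) / 2))"
proof -
  define t where "t = (2 * pi * inner a x + pi / 2 * b) / 2"
  have s: "of_real (sqrt 2) * of_real (sqrt 2) = (2::complex)"
    by (metis of_real_mult of_real_numeral real_sqrt_mult_self abs_numeral)
  have c: "Hgate * Rz (- (2 * t)) \<in> carrier_mat 2 2"
    by (intro mult_carrier_mat[of _ 2 2]) simp_all
  have "U1 a b x $$ (0,0) = (Hgate * Rz (- (2 * t)) * Hgate) $$ (0,0)"
    by (simp add: U1_eq t_def add_divide_distrib mult.assoc)
  also have "\<dots> = (exp (\<i> * of_real t) + exp (- (\<i> * of_real t))) / (of_real (sqrt 2) * of_real (sqrt 2))"
    using c by (simp add: mat2_mult_index Rz_index Hgate_index add_divide_distrib)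
  also have "\<dots> = of_real (cos t)"
    unfolding s by (simp add: cos_exp_eq flip: cos_of_real)
  finally show ?thesis by (simp add: t_def)
qed

section \<open>Amplitudes of the block-diagonal circuit\<close>

lemma sum_list_map_const:
  fixes c :: nat
  assumes "\<And>x. x \<in> set xs \<Longrightarrow> g x = c"
  shows "sum_list (map g xs) = c * length xs"
  using assms by (induction xs) simp_all

text \<open>Only entries with both indices even matter: the prepared state lives on the even basis
  vectors, and the network reads only even outcomes. The trailing block \<open>D\<close> stands for
  the identity padding.\<close>

lemma diag_block_mat_even_index:
  assumes "\<And>A. A \<in> set As \<Longrightarrow> A \<in> carrier_mat 2 2" and "D \<in> carrier_mat m m"
    and "i < length As" "j < length As"
  shows "diag_block_mat (As @ [D]) $$ (2 * i, 2 * j) = (if i = j then (As ! i) $$ (0,0) else 0)"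
  using assms
proof (induction As arbitrary: i j)
  case (Cons A As)
  have As: "B \<in> carrier_mat 2 2" if "B \<in> set As" for B
    using Cons.prems(1) that by simp
  have s: "sum_list (map dim_row As) = 2 * length As" "sum_list (map dim_col As) = 2 * length As"
    using As by (auto intro!: sum_list_map_const)
  have A: "dim_row A = 2" "dim_col A = 2" using Cons.prems(1)[of A] by simp_all
  have IH: "i < length As \<Longrightarrow> j < length As \<Longrightarrow>
      diag_block_mat (As @ [D]) $$ (2 * i, 2 * j) = (if i = j then (As ! i) $$ (0,0) else 0)" for i j
    by (rule Cons.IH[OF As Cons.prems(2)])
  have d: "dim_row (diag_block_mat (As @ [D])) = 2 * length As + m"
    "dim_col (diag_block_mat (As @ [D])) = 2 * length As + m"
    using Cons.prems(2) s by (auto simp: dim_diag_block_mat)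
  show ?case
  proof (cases i)
    case 0
    then show ?thesis using A d Cons.prems(3,4) by (cases j) (simp_all add: Let_def)
  next
    case (Suc i')
    then show ?thesis using A d Cons.prems(3,4) IH by (cases j) (simp_all add: Let_def)
  qed
qed simp

lemma Ubar_carrier: "Ubar n a b x \<in> carrier_mat (Nbar n) (Nbar n)"
proof -
  have "dim_row (U1 (a i) (b i) x) = 2" "dim_col (U1 (a i) (b i) x) = 2" for i
    using carrier_matD[OF U1_carrier[of "a i" "b i" x]] by simp_all
  then show ?thesis
    by (auto simp: Ubar_def Nbar_def dim_diag_block_mat comp_def sum_list_triv)
qed

text \<open>\<open>V\<close> enters only through its action on the first basis vector, which is the
  uniform superposition of the even ones. Among these, block j sends only its own vector to outcome
  2j, with the corner entry as amplitude; the normalisation 1 / sqrt n becomes 1 / n after squaring.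
  Blocks are numbered from 1, hence \<open>Suc j\<close>.\<close>

lemma Pbar_even:
  assumes V: "is_Vbar n V" and j: "j < n"
  shows "Pbar n V a b (2 * j) x
    = (cos ((2 * pi * inner (a (Suc j)) x + pi / 2 * b (Suc j)) / 2))\<^sup>2 / n"
proof -
  let ?N = "Nbar n" and ?U = "Ubar n a b x"
  define v where "v = V *\<^sub>v unit_vec ?N 0"
  have N: "2 * n \<le> ?N" by (simp add: Nbar_def)
  have v: "v = (1 / of_real (sqrt n)) \<cdot>\<^sub>v finsum_vec TYPE(complex) ?N (\<lambda>i. unit_vec ?N (2 * i)) {..<n}"
    using V by (simp add: is_Vbar_def v_def)
  have fc: "finsum_vec TYPE(complex) ?N (\<lambda>i. unit_vec ?N (2 * i)) {..<n} \<in> carrier_vec ?N"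
    by (rule finsum_vec_closed) auto
  have dv: "dim_vec v = ?N" using fc by (simp add: v)
  have vk: "vec_index v k = (1 / of_real (sqrt n)) * (\<Sum>i<n. if k = 2 * i then 1 else 0)" if "k < ?N" for k
  proof -
    have "vec_index (finsum_vec TYPE(complex) ?N (\<lambda>i. unit_vec ?N (2 * i)) {..<n}) k
        = (\<Sum>i<n. vec_index (unit_vec ?N (2 * i)) k)"
      using that by (intro index_finsum_vec) auto
    also have "\<dots> = (\<Sum>i<n. if k = 2 * i then 1 else 0)"
      using that N by (intro sum.cong) (auto simp: unit_vec_def)
    finally show ?thesis using that fc by (simp add: v)
  qed
  have U: "?U $$ (2 * j, 2 * i) = (if j = i then U1 (a (Suc j)) (b (Suc j)) x $$ (0,0) else 0)"
    if "i < n" for i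
    unfolding Ubar_def
    by (subst diag_block_mat_even_index[where m = "n0bar n"])
      (use that j in \<open>auto simp: nth_upt simp del: upt_Suc\<close>)
  have k: "2 * j < ?N" using j N by simp
  have dU: "dim_row ?U = ?N" "dim_col ?U = ?N" using Ubar_carrier[of n a b x] by auto
  have "vec_index (?U *\<^sub>v v) (2 * j) = (\<Sum>k<?N. ?U $$ (2 * j, k) * vec_index v k)"
    using k dU dv by (simp add: scalar_prod_def atLeast0LessThan)
  also have "\<dots> = (\<Sum>k<?N. \<Sum>i<n. if k = 2 * i then ?U $$ (2 * j, k) / of_real (sqrt n) else 0)"
    by (intro sum.cong) (auto simp: vk sum_distrib_left intro!: sum.cong)
  also have "\<dots> = (\<Sum>i<n. ?U $$ (2 * j, 2 * i) / of_real (sqrt n))"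
    using N by (subst sum.swap) (auto intro!: sum.cong)
  also have "\<dots> = (\<Sum>i<n. if j = i then U1 (a (Suc j)) (b (Suc j)) x $$ (0,0) / of_real (sqrt n) else 0)"
    by (intro sum.cong) (auto simp: U)
  also have "\<dots> = U1 (a (Suc j)) (b (Suc j)) x $$ (0,0) / of_real (sqrt n)"
    using j by simp
  finally have e: "vec_index (?U *\<^sub>v v) (2 * j)
      = of_real (cos ((2 * pi * inner (a (Suc j)) x + pi / 2 * b (Suc j)) / 2) / sqrt n)"
    by (simp add: U1_00)
  have cu: "conjugate (unit_vec ?N (2 * j)) = (unit_vec ?N (2 * j) :: complex vec)"
    by (rule eq_vecI) (auto simp: unit_vec_def)
  have "(?U *\<^sub>v v) \<bullet>c unit_vec ?N (2 * j) = vec_index (?U *\<^sub>v v) (2 * j)"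
    unfolding cu using k dU by (intro scalar_prod_right_unit) auto
  then show ?thesis
    unfolding Pbar_def v_def[symmetric] e norm_of_real
    by (simp only: norm_of_real power2_abs power_divide real_sqrt_pow2[OF of_nat_0_le_iff])
qed

text \<open>The double angle formula 2 cos^2 t - 1 = cos 2t explains the affine correction of the
  probabilities: it undoes both the square and the half angle.\<close>

lemma qrnn_eq:
  assumes "is_Vbar n V"
  shows "qrnn n V a b w x
    = (\<Sum>j<n. w j * cos (2 * pi * inner (a (Suc j)) x + pi / 2 * b (Suc j))) / n"
proof -
  have "2 * Pbar n V a b (2 * j) x - 1 / n
      = cos (2 * pi * inner (a (Suc j)) x + pi / 2 * b (Suc j)) / n" if "j < n" for j
  proof -
    define t where "t = (2 * pi * inner (a (Suc j)) x + pi / 2 * b (Suc j)) / 2"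
    have "2 * Pbar n V a b (2 * j) x - 1 / n = (2 * (cos t)\<^sup>2 - 1) / n"
      by (simp add: Pbar_even[OF assms that] t_def diff_divide_distrib)
    also have "\<dots> = cos (2 * t) / n"
      by (simp only: cos_double_cos)
    finally show ?thesis by (simp add: t_def add_divide_distrib mult.assoc)
  qed
  then show ?thesis by (simp add: qrnn_def sum_divide_distrib)
qed

section \<open>Fourier inversion\<close>

text \<open>The equation of integrals holds even for functions that are not integrable:
  integrability is invariant under the substitution, and both Bochner integrals are 0 by default
  otherwise.\<close>

lemma lborel_integral_affine:
  fixes h :: "'a::euclidean_space \<Rightarrow> 'b::{banach, second_countable_topology}"
  assumes [measurable]: "h \<in> borel_measurable borel" and c: "c \<noteq> 0"
  shows "(LINT x|lborel. h x) = \<bar>c\<bar> ^ DIM('a) *\<^sub>R (LINT x|lborel. h (t + c *\<^sub>R x))"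
    and "integrable lborel h \<longleftrightarrow> integrable lborel (\<lambda>x. h (t + c *\<^sub>R x))"
proof -
  let ?M = "density (distr lborel borel (\<lambda>x::'a. t + c *\<^sub>R x)) (\<lambda>_. ennreal (\<bar>c\<bar> ^ DIM('a)))"
  have M: "(lborel :: 'a measure) = ?M"
    using lborel_affine[OF c, of t] by simp
  have "(LINT x|lborel. h x) = (LINT x|?M. h x)"
    using M by simp
  also have "\<dots> = \<bar>c\<bar> ^ DIM('a) *\<^sub>R (LINT x|lborel. h (t + c *\<^sub>R x))"
    by (simp add: integral_density integral_distr)
  finally show "(LINT x|lborel. h x) = \<bar>c\<bar> ^ DIM('a) *\<^sub>R (LINT x|lborel. h (t + c *\<^sub>R x))" .
  have "integrable lborel h \<longleftrightarrow> integrable ?M h"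
    using M by simp
  also have "\<dots> \<longleftrightarrow> integrable lborel (\<lambda>x. h (t + c *\<^sub>R x))"
  proof -
    have "integrable lborel (\<lambda>x. \<bar>c\<bar> ^ DIM('a) *\<^sub>R h (t + c *\<^sub>R x))
        \<longleftrightarrow> integrable lborel (\<lambda>x. h (t + c *\<^sub>R x))"
      using c integrable_scaleR_right[of "\<bar>c\<bar> ^ DIM('a)" lborel "\<lambda>x. h (t + c *\<^sub>R x)"]
        integrable_scaleR_right[of "inverse (\<bar>c\<bar> ^ DIM('a))" lborel
          "\<lambda>x. \<bar>c\<bar> ^ DIM('a) *\<^sub>R h (t + c *\<^sub>R x)"]
      by auto
    then show ?thesis
      by (simp add: integrable_density integrable_distr_eq)
  qed
  finally show "integrable lborel h \<longleftrightarrow> integrable lborel (\<lambda>x. h (t + c *\<^sub>R x))" .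
qed

text \<open>Up to the factor sqrt (2 pi) of the normal density this is the characteristic function
  of the standard normal distribution.\<close>

lemma fourier_gaussian_real:
  fixes t :: real
  shows "integrable lborel (\<lambda>s. exp (\<i> * of_real (s * t)) * of_real (exp (- s\<^sup>2 / 2)))"
    and "(LINT s|lborel. exp (\<i> * of_real (s * t)) * of_real (exp (- s\<^sup>2 / 2)))
      = of_real (sqrt (2 * pi) * exp (- t\<^sup>2 / 2))"
proof -
  have eq: "exp (\<i> * of_real (s * t)) * of_real (exp (- s\<^sup>2 / 2))
      = of_real (sqrt (2 * pi)) * (std_normal_density s *\<^sub>R exp (\<i> * of_real (t * s)))" for s :: real
    by (simp add: std_normal_density_def scaleR_conv_of_real mult.commute)
  interpret N: real_distribution std_normal_distribution
    by (rule real_dist_normal_dist)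
  have "integrable std_normal_distribution (\<lambda>s. exp (\<i> * of_real (t * s)))"
    by (rule N.integrable_const_bound[where B = 1]) (auto simp: norm_exp_i_times)
  then have i: "integrable lborel (\<lambda>s. std_normal_density s *\<^sub>R exp (\<i> * of_real (t * s)))"
    by (subst (asm) integrable_density) (auto simp: normal_density_nonneg)
  then show "integrable lborel (\<lambda>s. exp (\<i> * of_real (s * t)) * of_real (exp (- s\<^sup>2 / 2)))"
    unfolding eq by (intro integrable_mult_right)
  have "(LINT s|lborel. std_normal_density s *\<^sub>R exp (\<i> * of_real (t * s)))
      = char std_normal_distribution t"
    unfolding char_def by (subst integral_density) (auto simp: normal_density_nonneg)
  then show "(LINT s|lborel. exp (\<i> * of_real (s * t)) * of_real (exp (- s\<^sup>2 / 2)))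
      = of_real (sqrt (2 * pi) * exp (- t\<^sup>2 / 2))"
    unfolding eq by (simp add: char_std_normal_distribution del: mult_scaleR_right)
qed

text \<open>Inner product and squared norm are sums over the orthonormal basis, so the integrand is
  a product of one-dimensional ones; Lebesgue measure is the image of the product measure over
  \<open>Basis\<close>.\<close>

lemma fourier_gaussian:
  fixes u :: "'a::euclidean_space"
  shows "integrable lborel (\<lambda>z. exp (\<i> * of_real (inner z u)) * of_real (exp (- (norm z)\<^sup>2 / 2)))"
      (is "integrable _ ?h")
    and "(LINT z|lborel. exp (\<i> * of_real (inner z u)) * of_real (exp (- (norm z)\<^sup>2 / 2)))
      = of_real (sqrt (2 * pi) ^ DIM('a) * exp (- (norm u)\<^sup>2 / 2))"
proof -
  interpret product_sigma_finite "\<lambda>_::'a. lborel :: real measure"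
    by standard
  define g where "g b s = exp (\<i> * of_real (s * inner u b)) * complex_of_real (exp (- s\<^sup>2 / 2))" for b s
  let ?P = "PiM (Basis :: 'a set) (\<lambda>_. lborel :: real measure)"
  let ?T = "\<lambda>y. \<Sum>b\<in>Basis. y b *\<^sub>R (b::'a)"
  have nrm: "(norm v)\<^sup>2 = (\<Sum>b\<in>Basis. (inner v b)\<^sup>2)" for v :: 'a
    unfolding power2_norm_eq_inner using euclidean_inner[of v v] by (simp only: power2_eq_square)
  have h: "?h (?T y) = (\<Prod>b\<in>Basis. g b (y b))" for y
  proof -
    have "inner (?T y) u = (\<Sum>b\<in>Basis. y b * inner u b)"
      by (simp add: inner_sum_left inner_commute[of u])
    moreover have "(norm (?T y))\<^sup>2 = (\<Sum>b\<in>Basis. (y b)\<^sup>2)"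
      by (simp add: nrm)
    ultimately show ?thesis
      by (simp add: g_def prod.distrib exp_sum sum_distrib_left sum_divide_distrib
          flip: sum_negf exp_of_real of_real_sum)
        (simp add: exp_sum sum_distrib_left flip: exp_of_real)
  qed
  have gi: "integrable lborel (g b)" for b
    unfolding g_def by (rule fourier_gaussian_real)
  have [measurable]: "?h \<in> borel_measurable borel" by measurable
  have [measurable]: "?T \<in> ?P \<rightarrow>\<^sub>M borel" by measurable
  have "integrable ?P (\<lambda>y. ?h (?T y))"
    unfolding h by (intro product_integrable_prod gi) auto
  then show "integrable lborel ?h"
    by (subst lborel_eq) (simp add: integrable_distr_eq)
  have "(LINT z|lborel. ?h z) = (LINT y|?P. ?h (?T y))"
    by (subst lborel_eq) (simp add: integral_distr)
  also have "\<dots> = (\<Prod>b\<in>Basis. LINT s|lborel. g b s)"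
    unfolding h by (intro product_integral_prod gi) auto
  also have "\<dots> = (\<Prod>b\<in>Basis. of_real (sqrt (2 * pi) * exp (- (inner u b)\<^sup>2 / 2)))"
    unfolding g_def by (simp only: fourier_gaussian_real)
  also have "\<dots> = of_real (sqrt (2 * pi) ^ DIM('a) * exp (- (norm u)\<^sup>2 / 2))"
    by (simp add: nrm prod.distrib exp_sum sum_divide_distrib flip: sum_negf of_real_prod)
  finally show "(LINT z|lborel. ?h z)
      = of_real (sqrt (2 * pi) ^ DIM('a) * exp (- (norm u)\<^sup>2 / 2))" .
qed

lemma gaussian_integral:
  shows "integrable lborel (\<lambda>z::'a::euclidean_space. exp (- (norm z)\<^sup>2 / 2))"
    and "(LINT z|lborel. exp (- (norm (z::'a))\<^sup>2 / 2)) = sqrt (2 * pi) ^ DIM('a)"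
proof -
  have "integrable lborel (\<lambda>z::'a. complex_of_real (exp (- (norm z)\<^sup>2 / 2)))"
    using fourier_gaussian(1)[of "0::'a"] by simp
  then show "integrable lborel (\<lambda>z::'a. exp (- (norm z)\<^sup>2 / 2))"
    by (simp only: complex_of_real_integrable_eq)
  have "complex_of_real (LINT z|lborel. exp (- (norm (z::'a))\<^sup>2 / 2)) = of_real (sqrt (2 * pi) ^ DIM('a))"
    using fourier_gaussian(2)[of "0::'a"] by (simp flip: integral_complex_of_real)
  then show "(LINT z|lborel. exp (- (norm (z::'a))\<^sup>2 / 2)) = sqrt (2 * pi) ^ DIM('a)"
    by (simp only: of_real_eq_iff)
qed

section \<open>Inversion by Gaussian damping\<close>

text \<open>Without damping the double integrand has modulus |f y|, which is not integrable in the
  frequency. The Gaussian factor turns the modulus into a product of two integrable functions, so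
  the order of integration can be exchanged; the frequency integral is then a Gaussian concentrated
  around x at scale 1 / (2 pi s).\<close>

lemma damped_inverse_fourier:
  fixes f :: "'a::euclidean_space \<Rightarrow> complex"
  assumes f: "integrable lborel f" and s: "s > 0"
  shows "(LINT \<xi>|lborel. exp (2 * of_real pi * \<i> * of_real (inner x \<xi>)) *
        of_real (exp (- (norm (\<xi> /\<^sub>R s))\<^sup>2 / 2)) *
        (LINT y|lborel. exp (- 2 * of_real pi * \<i> * of_real (inner y \<xi>)) * f y))
    = (LINT y|lborel. of_real ((s * sqrt (2 * pi)) ^ DIM('a) *
        exp (- (norm ((2 * pi * s) *\<^sub>R (x - y)))\<^sup>2 / 2)) * f y)"
proof -
  define G where "G = (\<lambda>\<xi>::'a. complex_of_real (exp (- (norm (\<xi> /\<^sub>R s))\<^sup>2 / 2)))"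
  define K where "K = (\<lambda>(\<xi>, y). exp (\<i> * of_real (inner \<xi> ((2 * pi) *\<^sub>R (x - y)))) * G \<xi> * f y)"
  have [measurable]: "f \<in> borel_measurable borel"
    using borel_measurable_integrable[OF f] by simp
  have [measurable]: "G \<in> borel_measurable borel"
    unfolding G_def by measurable
  have Gi: "integrable lborel G"
  proof -
    have "G (0 + s *\<^sub>R \<xi>) = of_real (exp (- (norm \<xi>)\<^sup>2 / 2))" for \<xi>
      using s by (simp add: G_def)
    then show ?thesis
      using lborel_integral_affine(2)[of G s 0] s gaussian_integral(1)[where 'a = 'a] by simp
  qed
  have Kn: "norm (K (\<xi>, y)) = norm (G \<xi>) * norm (f y)" for \<xi> y
    by (simp add: K_def norm_mult)
  have K: "integrable (lborel \<Otimes>\<^sub>M lborel) K"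
  proof (rule lborel_pair.Fubini_integrable)
    show "K \<in> borel_measurable (lborel \<Otimes>\<^sub>M lborel)"
      unfolding K_def by measurable
    show "integrable lborel (\<lambda>\<xi>. LINT y|lborel. norm (K (\<xi>, y)))"
      unfolding Kn using Gi by simp
    show "AE \<xi> in lborel. integrable lborel (\<lambda>y. K (\<xi>, y))"
    proof (rule AE_I2)
      fix \<xi> :: 'a
      show "integrable lborel (\<lambda>y. K (\<xi>, y))"
      proof (rule Bochner_Integration.integrable_bound)
        show "integrable lborel (\<lambda>y. norm (G \<xi>) * norm (f y))" using f by simp
        show "(\<lambda>y. K (\<xi>, y)) \<in> borel_measurable lborel" unfolding K_def prod.case by measurable
      qed (simp add: Kn)
    qed
  qed
  have split: "exp (2 * of_real pi * \<i> * of_real (inner x \<xi>)) * exp (- 2 * of_real pi * \<i> * of_real (inner y \<xi>))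
      = exp (\<i> * of_real (inner \<xi> ((2 * pi) *\<^sub>R (x - y))))" for y \<xi> :: 'a
    by (simp add: inner_diff_right inner_commute algebra_simps flip: exp_add)
  have "(LINT \<xi>|lborel. exp (2 * of_real pi * \<i> * of_real (inner x \<xi>)) * G \<xi> *
        (LINT y|lborel. exp (- 2 * of_real pi * \<i> * of_real (inner y \<xi>)) * f y))
      = (LINT \<xi>|lborel. LINT y|lborel. K (\<xi>, y))"
  proof (rule Bochner_Integration.integral_cong[OF refl])
    fix \<xi> :: 'a
    have "exp (2 * of_real pi * \<i> * of_real (inner x \<xi>)) * G \<xi> *
        (LINT y|lborel. exp (- 2 * of_real pi * \<i> * of_real (inner y \<xi>)) * f y)
      = (LINT y|lborel. exp (2 * of_real pi * \<i> * of_real (inner x \<xi>)) * G \<xi> *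
          (exp (- 2 * of_real pi * \<i> * of_real (inner y \<xi>)) * f y))"
      by (rule integral_mult_right_zero[symmetric])
    also have "\<dots> = (LINT y|lborel. K (\<xi>, y))"
      unfolding K_def prod.case split[symmetric] by (simp only: mult_ac)
    finally show "exp (2 * of_real pi * \<i> * of_real (inner x \<xi>)) * G \<xi> *
        (LINT y|lborel. exp (- 2 * of_real pi * \<i> * of_real (inner y \<xi>)) * f y) = (LINT y|lborel. K (\<xi>, y))" .
  qed
  also have "\<dots> = (LINT y|lborel. LINT \<xi>|lborel. K (\<xi>, y))"
    using lborel_pair.Fubini_integral[of "\<lambda>\<xi> y. K (\<xi>, y)"] K by simp
  also have "\<dots> = (LINT y|lborel. of_real ((s * sqrt (2 * pi)) ^ DIM('a) *
        exp (- (norm ((2 * pi * s) *\<^sub>R (x - y)))\<^sup>2 / 2)) * f y)"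
  proof (rule Bochner_Integration.integral_cong[OF refl])
    fix y :: 'a
    let ?u = "(2 * pi) *\<^sub>R (x - y)"
    have "(LINT \<xi>|lborel. K (\<xi>, y)) = (LINT \<xi>|lborel. exp (\<i> * of_real (inner \<xi> ?u)) * G \<xi>) * f y"
      unfolding K_def prod.case by (rule integral_mult_left_zero)
    \<comment> \<open>Substituting xi = s z makes the Gaussian standard and moves the scale into the
      frequency variable.\<close>
    also have "(LINT \<xi>|lborel. exp (\<i> * of_real (inner \<xi> ?u)) * G \<xi>)
        = s ^ DIM('a) *\<^sub>R (LINT z|lborel. exp (\<i> * of_real (inner (0 + s *\<^sub>R z) ?u)) * G (0 + s *\<^sub>R z))"
      using s by (subst lborel_integral_affine(1)[where c = s and t = 0]) auto
    also have "(LINT z|lborel. exp (\<i> * of_real (inner (0 + s *\<^sub>R z) ?u)) * G (0 + s *\<^sub>R z))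
        = (LINT z|lborel. exp (\<i> * of_real (inner z ((2 * pi * s) *\<^sub>R (x - y)))) * of_real (exp (- (norm z)\<^sup>2 / 2)))"
    proof -
      have "G (0 + s *\<^sub>R z) = of_real (exp (- (norm z)\<^sup>2 / 2))" for z
        using s by (simp add: G_def)
      moreover have "inner (0 + s *\<^sub>R z) ?u = inner z ((2 * pi * s) *\<^sub>R (x - y))" for z :: 'a
        by (simp add: mult_ac)
      ultimately show ?thesis by (simp only:)
    qed
    also have "\<dots> = of_real (sqrt (2 * pi) ^ DIM('a) * exp (- (norm ((2 * pi * s) *\<^sub>R (x - y)))\<^sup>2 / 2))"
      by (rule fourier_gaussian(2))
    finally show "(LINT \<xi>|lborel. K (\<xi>, y)) = of_real ((s * sqrt (2 * pi)) ^ DIM('a) *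
        exp (- (norm ((2 * pi * s) *\<^sub>R (x - y)))\<^sup>2 / 2)) * f y"
      by (simp add: scaleR_conv_of_real power_mult_distrib)
  qed
  finally show ?thesis
    by (simp add: G_def)
qed

text \<open>Used for the kernel away from its centre: its height grows like the power, and the
  Gaussian decay has to win. Completing the square, (a s - 1)^2 >= 0, bounds the Gaussian by a
  multiple of exp (- a s), for which the limit is known.\<close>

lemma power_times_gaussian_tendsto_0:
  assumes a: "a > 0"
  shows "(\<lambda>n. real (Suc n) ^ k * exp (- (a * real (Suc n))\<^sup>2 / 2)) \<longlonglongrightarrow> 0"
proof (rule tendsto_sandwich[OF _ _ tendsto_const])
  have "filterlim (\<lambda>n. a * real (Suc n)) at_top sequentially"
    using a by (intro filterlim_tendsto_pos_mult_at_top[OF tendsto_const]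
        filterlim_compose[OF filterlim_real_sequentially filterlim_Suc])
  then have "(\<lambda>n. (a * real (Suc n)) ^ k / exp (a * real (Suc n))) \<longlonglongrightarrow> 0"
    by (rule filterlim_compose[OF tendsto_power_div_exp_0])
  then show "(\<lambda>n. exp (1/2) / a ^ k * ((a * real (Suc n)) ^ k / exp (a * real (Suc n)))) \<longlonglongrightarrow> 0"
    by (rule tendsto_mult_right_zero)
  show "\<forall>\<^sub>F n in sequentially. real (Suc n) ^ k * exp (- (a * real (Suc n))\<^sup>2 / 2)
      \<le> exp (1/2) / a ^ k * ((a * real (Suc n)) ^ k / exp (a * real (Suc n)))"
  proof (rule always_eventually, rule allI)
    fix n
    let ?s = "real (Suc n)"
    have "0 \<le> (a * ?s - 1)\<^sup>2" by simp
    then have "- (a * ?s)\<^sup>2 / 2 \<le> 1/2 - a * ?s"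
      by (simp add: power2_diff algebra_simps)
    then have "exp (- (a * ?s)\<^sup>2 / 2) \<le> exp (1/2) / exp (a * ?s)"
      by (simp flip: exp_diff)
    then have "?s ^ k * exp (- (a * ?s)\<^sup>2 / 2) \<le> ?s ^ k * (exp (1/2) / exp (a * ?s))"
      by (intro mult_left_mono) auto
    also have "\<dots> = exp (1/2) / a ^ k * ((a * ?s) ^ k / exp (a * ?s))"
      using a by (simp add: power_mult_distrib)
    finally show "?s ^ k * exp (- (a * ?s)\<^sup>2 / 2) \<le> exp (1/2) / a ^ k * ((a * ?s) ^ k / exp (a * ?s))" .
  qed
qed (auto intro!: always_eventually)

text \<open>Continuity at \<open>x\<close> does not make \<open>f\<close> bounded, hence the split at a ball: near \<open>x\<close> the
  function is bounded, away from \<open>x\<close> the kernel tends to \<open>0\<close> uniformly.\<close>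

lemma gaussian_approximate_identity:
  fixes f :: "'a::euclidean_space \<Rightarrow> complex"
  assumes f: "integrable lborel f" and cont: "isCont f x"
  shows "(\<lambda>n. LINT y|lborel. of_real ((real (Suc n) * sqrt (2 * pi)) ^ DIM('a) *
      exp (- (norm ((2 * pi * real (Suc n)) *\<^sub>R (x - y)))\<^sup>2 / 2)) * f y) \<longlonglongrightarrow> f x"
proof -
  define k where "k n y = (real (Suc n) * sqrt (2 * pi)) ^ DIM('a) *
      exp (- (norm ((2 * pi * real (Suc n)) *\<^sub>R (x - y)))\<^sup>2 / 2)" for n and y :: 'a
  have kmeas [measurable]: "k n \<in> borel_measurable borel" for n
    unfolding k_def by measurable
  have fmeas [measurable]: "f \<in> borel_measurable borel"
    using borel_measurable_integrable[OF f] by simp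
  \<comment> \<open>Tolerance 1 is enough: the ball only has to make \<open>f\<close> bounded. The
    limit itself comes from dominated convergence.\<close>
  obtain \<delta> where \<delta>: "\<delta> > 0" and near: "\<And>y. dist y x < \<delta> \<Longrightarrow> dist (f y) (f x) < 1"
    using cont[unfolded continuous_at_eps_delta, rule_format, of 1] by auto
  define g where "g y = indicator (ball x \<delta>) y *\<^sub>R f y" for y
  define h where "h y = indicator (- ball x \<delta>) y *\<^sub>R f y" for y
  have fgh: "f y = g y + h y" for y
    by (simp add: g_def h_def split: split_indicator)
  have [measurable]: "g \<in> borel_measurable borel" "h \<in> borel_measurable borel"
    unfolding g_def h_def
    by (auto intro!: borel_measurable_scaleR borel_measurable_indicator)
  have gb: "norm (g y) \<le> norm (f x) + 1" for y
  proof (cases "dist y x < \<delta>")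
    case True
    then show ?thesis
      using near[of y] norm_triangle_ineq2[of "f y" "f x"] by (auto simp: g_def dist_norm split: split_indicator)
  qed (simp add: g_def dist_commute indicator_def)
  have kb: "norm (of_real (k n y) :: complex) \<le> (real (Suc n) * sqrt (2 * pi)) ^ DIM('a)" for n y
    unfolding norm_of_real k_def abs_mult by (simp add: mult_left_le del: of_nat_Suc)
  have fi: "integrable lborel (\<lambda>y. of_real (k n y) * w y)" if w: "integrable lborel w" for n and w :: "'a \<Rightarrow> complex"
  proof (rule Bochner_Integration.integrable_bound)
    show "integrable lborel (\<lambda>y. (real (Suc n) * sqrt (2 * pi)) ^ DIM('a) * norm (w y))"
      using w by simp
    have [measurable]: "w \<in> borel_measurable borel"
      using borel_measurable_integrable[OF w] by simp
    show "(\<lambda>y. of_real (k n y) * w y) \<in> borel_measurable lborel" by measurable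
    show "AE y in lborel. norm (of_real (k n y) * w y)
        \<le> norm ((real (Suc n) * sqrt (2 * pi)) ^ DIM('a) * norm (w y))"
      using kb by (intro AE_I2) (auto simp: norm_mult intro!: mult_mono)
  qed
  have gi: "integrable lborel g" and hi: "integrable lborel h"
    unfolding g_def h_def using f by (auto intro!: integrable_mult_indicator)
  have G: "(\<lambda>n. LINT y|lborel. of_real (k n y) * g y) \<longlonglongrightarrow> f x"
  proof -
    \<comment> \<open>\<open>?r n\<close> is the width of the kernel. In the variable z with y = x +
      \<open>?r n\<close> z the Gaussian no longer depends on n, and only the argument of
      \<open>g\<close> moves.\<close>
    let ?r = "\<lambda>n. 1 / (2 * pi * real (Suc n))"
    have eq: "(LINT y|lborel. of_real (k n y) * g y)
        = (LINT z|lborel. of_real (exp (- (norm (z::'a))\<^sup>2 / 2)) * g (x + ?r n *\<^sub>R z)) / of_real (sqrt (2 * pi) ^ DIM('a))" for n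
    proof -
      have "(LINT y|lborel. of_real (k n y) * g y)
          = \<bar>?r n\<bar> ^ DIM('a) *\<^sub>R (LINT z|lborel. of_real (k n (x + ?r n *\<^sub>R z)) * g (x + ?r n *\<^sub>R z))"
        by (rule lborel_integral_affine(1)) (auto simp del: of_nat_Suc)
      also have "(\<lambda>z. of_real (k n (x + ?r n *\<^sub>R z)) * g (x + ?r n *\<^sub>R z))
          = (\<lambda>z. of_real ((real (Suc n) * sqrt (2 * pi)) ^ DIM('a)) *
              (of_real (exp (- (norm z)\<^sup>2 / 2)) * g (x + ?r n *\<^sub>R z)))"
        by (simp add: k_def mult_ac fun_eq_iff del: of_nat_Suc)
      also have "\<bar>?r n\<bar> ^ DIM('a) *\<^sub>R (LINT z|lborel. of_real ((real (Suc n) * sqrt (2 * pi)) ^ DIM('a)) *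
              (of_real (exp (- (norm z)\<^sup>2 / 2)) * g (x + ?r n *\<^sub>R z)))
          = of_real (\<bar>?r n\<bar> ^ DIM('a) * (real (Suc n) * sqrt (2 * pi)) ^ DIM('a)) *
            (LINT z|lborel. of_real (exp (- (norm z)\<^sup>2 / 2)) * g (x + ?r n *\<^sub>R z))"
        by (simp add: scaleR_conv_of_real)
      \<comment> \<open>Jacobian times height of the kernel is the normalising constant of the
        standard Gaussian, so the kernel has mass 1.\<close>
      also have "\<bar>?r n\<bar> ^ DIM('a) * (real (Suc n) * sqrt (2 * pi)) ^ DIM('a) = 1 / sqrt (2 * pi) ^ DIM('a)"
      proof -
        have "\<bar>?r n\<bar> * (real (Suc n) * sqrt (2 * pi)) = sqrt (2 * pi) / (2 * pi)"
          by (simp add: abs_mult del: of_nat_Suc)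
        also have "\<dots> = 1 / sqrt (2 * pi)"
          by (subst real_div_sqrt[symmetric]) (auto simp: field_simps)
        finally show ?thesis
          by (metis power_mult_distrib power_one_over)
      qed
      finally show ?thesis by simp
    qed
    have "(\<lambda>n. LINT z|lborel. of_real (exp (- (norm (z::'a))\<^sup>2 / 2)) * g (x + ?r n *\<^sub>R z))
        \<longlonglongrightarrow> (LINT z|lborel. of_real (exp (- (norm (z::'a))\<^sup>2 / 2)) * f x)"
    proof (rule integral_dominated_convergence[where w = "\<lambda>z. exp (- (norm z)\<^sup>2 / 2) * (norm (f x) + 1)"])
      show "integrable lborel (\<lambda>z::'a. exp (- (norm z)\<^sup>2 / 2) * (norm (f x) + 1))"
        by (intro integrable_mult_left gaussian_integral)
      show "AE z in lborel. (\<lambda>n. of_real (exp (- (norm (z::'a))\<^sup>2 / 2)) * g (x + ?r n *\<^sub>R z))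
          \<longlonglongrightarrow> of_real (exp (- (norm z)\<^sup>2 / 2)) * f x"
      proof (intro AE_I2 tendsto_intros)
        fix z :: 'a
        have "?r \<longlonglongrightarrow> 0"
          by real_asymp
        then have lim: "(\<lambda>n. x + ?r n *\<^sub>R z) \<longlonglongrightarrow> x"
          using tendsto_add[OF tendsto_const tendsto_scaleR[OF _ tendsto_const], of ?r 0 sequentially x z]
          by (simp del: of_nat_Suc)
        have "(\<lambda>n. f (x + ?r n *\<^sub>R z)) \<longlonglongrightarrow> f x"
          by (rule isCont_tendsto_compose[OF cont lim])
        moreover have "\<forall>\<^sub>F n in sequentially. f (x + ?r n *\<^sub>R z) = g (x + ?r n *\<^sub>R z)"
          using tendstoD[OF lim \<delta>] by eventually_elim (simp add: g_def dist_commute)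
        ultimately show "(\<lambda>n. g (x + ?r n *\<^sub>R z)) \<longlonglongrightarrow> f x"
          by (rule Lim_transform_eventually)
      qed
      show "AE z in lborel. norm (of_real (exp (- (norm (z::'a))\<^sup>2 / 2)) * g (x + ?r n *\<^sub>R z))
          \<le> exp (- (norm z)\<^sup>2 / 2) * (norm (f x) + 1)" for n
        using gb by (intro AE_I2) (auto simp: norm_mult intro!: mult_left_mono)
    qed measurable
    then have "(\<lambda>n. LINT y|lborel. of_real (k n y) * g y)
        \<longlonglongrightarrow> (LINT z|lborel. of_real (exp (- (norm (z::'a))\<^sup>2 / 2)) * f x) / of_real (sqrt (2 * pi) ^ DIM('a))"
      unfolding eq by (intro tendsto_divide tendsto_const) auto
    also have "(LINT z|lborel. of_real (exp (- (norm (z::'a))\<^sup>2 / 2)) * f x) / of_real (sqrt (2 * pi) ^ DIM('a)) = f x"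
      using gaussian_integral[where 'a = 'a] by (simp only: integral_mult_left_zero integral_complex_of_real) simp
    finally show ?thesis .
  qed
  have H: "(\<lambda>n. LINT y|lborel. of_real (k n y) * h y) \<longlonglongrightarrow> 0"
  proof (rule Lim_null_comparison)
    let ?p = "\<lambda>n. real (Suc n) ^ DIM('a) * exp (- (2 * pi * \<delta> * real (Suc n))\<^sup>2 / 2)"
    have "?p \<longlonglongrightarrow> 0"
      using \<delta> by (intro power_times_gaussian_tendsto_0) simp
    then show "(\<lambda>n. ?p n * (sqrt (2 * pi) ^ DIM('a) * (LINT y|lborel. norm (h y)))) \<longlonglongrightarrow> 0"
      by (rule tendsto_mult_left_zero)
    show "\<forall>\<^sub>F n in sequentially. norm (LINT y|lborel. of_real (k n y) * h y)
        \<le> ?p n * (sqrt (2 * pi) ^ DIM('a) * (LINT y|lborel. norm (h y)))"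
    proof (rule always_eventually, rule allI)
      fix n
      have b: "norm (of_real (k n y) * h y) \<le> ?p n * sqrt (2 * pi) ^ DIM('a) * norm (h y)" for y
      proof (cases "y \<in> ball x \<delta>")
        case False
        then have "\<delta> \<le> norm (x - y)" by (simp add: dist_norm)
        then have "(2 * pi * \<delta> * real (Suc n))\<^sup>2 \<le> (norm ((2 * pi * real (Suc n)) *\<^sub>R (x - y)))\<^sup>2"
          using \<delta> by (intro power_mono) (auto simp: mult_ac intro!: mult_left_mono)
        then have "k n y \<le> ?p n * sqrt (2 * pi) ^ DIM('a)"
          unfolding k_def power_mult_distrib[of "real (Suc n)" "sqrt (2 * pi)"]
          by (simp add: mult_ac del: of_nat_Suc)
        moreover have "0 \<le> k n y" by (simp add: k_def)
        ultimately show ?thesis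
          unfolding norm_mult norm_of_real by (intro mult_right_mono) auto
      qed (simp add: h_def)
      have "norm (LINT y|lborel. of_real (k n y) * h y) \<le> (LINT y|lborel. norm (of_real (k n y) * h y))"
        by (rule Bochner_Integration.integral_norm_bound)
      also have "\<dots> \<le> (LINT y|lborel. ?p n * sqrt (2 * pi) ^ DIM('a) * norm (h y))"
        using b hi by (intro integral_mono integrable_norm fi) auto
      also have "\<dots> = ?p n * (sqrt (2 * pi) ^ DIM('a) * (LINT y|lborel. norm (h y)))"
        by simp
      finally show "norm (LINT y|lborel. of_real (k n y) * h y)
        \<le> ?p n * (sqrt (2 * pi) ^ DIM('a) * (LINT y|lborel. norm (h y)))" .
    qed
  qed
  have "(LINT y|lborel. of_real (k n y) * f y)
      = (LINT y|lborel. of_real (k n y) * g y) + (LINT y|lborel. of_real (k n y) * h y)" for n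
    using fi[OF gi] fi[OF hi] by (simp add: fgh distrib_left)
  then show ?thesis
    using tendsto_add[OF G H] by (simp add: k_def del: of_nat_Suc)
qed

text \<open>The damped integrals \<open>?I n\<close> have two limits: the value f x, since the
  kernel is an approximate identity, and the undamped integral, by dominated convergence with
  majorant |F|. The latter is where integrability of the transform enters.\<close>

theorem fourier_inversion:
  fixes f :: "'a::euclidean_space \<Rightarrow> complex"
  defines "F \<equiv> \<lambda>\<xi>. LINT y|lborel. exp (- 2 * of_real pi * \<i> * of_real (inner y \<xi>)) * f y"
  assumes f: "integrable lborel f" and F: "integrable lborel F" and cont: "isCont f x"
  shows "(LINT \<xi>|lborel. exp (2 * of_real pi * \<i> * of_real (inner x \<xi>)) * F \<xi>) = f x"
proof (rule LIMSEQ_unique)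
  have [measurable]: "F \<in> borel_measurable borel"
    using borel_measurable_integrable[OF F] by simp
  let ?I = "\<lambda>n. LINT \<xi>|lborel. exp (2 * of_real pi * \<i> * of_real (inner x \<xi>)) *
      of_real (exp (- (norm (\<xi> /\<^sub>R real (Suc n)))\<^sup>2 / 2)) * F \<xi>"
  have n1: "norm (exp (2 * of_real pi * \<i> * of_real r)) = 1" for r
    using norm_exp_i_times[of "2 * pi * r"] by (simp add: mult_ac)
  show "?I \<longlonglongrightarrow> f x"
    using gaussian_approximate_identity[OF f cont] unfolding F_def
    by (subst damped_inverse_fourier[OF f]) auto
  show "?I \<longlonglongrightarrow> (LINT \<xi>|lborel. exp (2 * of_real pi * \<i> * of_real (inner x \<xi>)) * F \<xi>)"
  proof (rule integral_dominated_convergence[where w = "\<lambda>\<xi>. norm (F \<xi>)"])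
    show "integrable lborel (\<lambda>\<xi>. norm (F \<xi>))" using F by simp
    show "AE \<xi> in lborel. (\<lambda>n. exp (2 * of_real pi * \<i> * of_real (inner x \<xi>)) *
        of_real (exp (- (norm (\<xi> /\<^sub>R real (Suc n)))\<^sup>2 / 2)) * F \<xi>)
        \<longlonglongrightarrow> exp (2 * of_real pi * \<i> * of_real (inner x \<xi>)) * F \<xi>"
    proof (rule AE_I2)
      fix \<xi> :: 'a
      have "(\<lambda>n. inverse (real (Suc n))) \<longlonglongrightarrow> 0"
        by (rule LIMSEQ_inverse_real_of_nat)
      then have "(\<lambda>n. complex_of_real (exp (- (norm (\<xi> /\<^sub>R real (Suc n)))\<^sup>2 / 2))) \<longlonglongrightarrow> of_real (exp (- (norm (0 *\<^sub>R \<xi>))\<^sup>2 / 2))"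
        by (intro tendsto_intros) auto
      then have "(\<lambda>n. exp (2 * of_real pi * \<i> * of_real (inner x \<xi>)) *
          of_real (exp (- (norm (\<xi> /\<^sub>R real (Suc n)))\<^sup>2 / 2)) * F \<xi>)
        \<longlonglongrightarrow> exp (2 * of_real pi * \<i> * of_real (inner x \<xi>)) * of_real (exp (- (norm (0 *\<^sub>R \<xi>))\<^sup>2 / 2)) * F \<xi>"
        by (intro tendsto_mult tendsto_const)
      then show "(\<lambda>n. exp (2 * of_real pi * \<i> * of_real (inner x \<xi>)) *
          of_real (exp (- (norm (\<xi> /\<^sub>R real (Suc n)))\<^sup>2 / 2)) * F \<xi>)
        \<longlonglongrightarrow> exp (2 * of_real pi * \<i> * of_real (inner x \<xi>)) * F \<xi>"
        by (simp del: of_nat_Suc)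
    qed
    show "AE \<xi> in lborel. norm (exp (2 * of_real pi * \<i> * of_real (inner x \<xi>)) *
        of_real (exp (- (norm (\<xi> /\<^sub>R real (Suc n)))\<^sup>2 / 2)) * F \<xi>) \<le> norm (F \<xi>)" for n
      by (intro AE_I2) (simp add: norm_mult n1 mult_left_le_one_le del: of_nat_Suc)
  qed measurable
qed

section \<open>Symmetrization and contraction\<close>

text \<open>Processes are sequences rather than functions on the cube because a countable supremum
  is measurable for the product sigma-algebra.\<close>

abbreviation seq_space :: "(nat \<Rightarrow> real) measure" where
  "seq_space \<equiv> PiM UNIV (\<lambda>_. borel)"

text \<open>Coercion to \<open>ennreal\<close> truncates negative values at \<open>0\<close>. This is harmless because the
  sequences below are processes along a dense sequence of points whose member with index \<open>0\<close> is the
  origin, where the processes vanish.\<close>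

definition pos_sup :: "(nat \<Rightarrow> real) \<Rightarrow> ennreal" where
  "pos_sup g = (SUP i. ennreal (g i))"

lemma measurable_seq_spaceI:
  assumes "\<And>i. (\<lambda>x. f x i) \<in> borel_measurable N"
  shows "f \<in> N \<rightarrow>\<^sub>M seq_space"
  using assms by (intro measurable_PiM_single') auto

lemma pos_sup_measurable [measurable]: "pos_sup \<in> borel_measurable seq_space"
  unfolding pos_sup_def[abs_def] by measurable

text \<open>The two suprema have independent indices, so contraction becomes a statement about a
  single pair (i, j).\<close>

lemma pos_sup_add_le_iff:
  "pos_sup g + pos_sup h \<le> c \<longleftrightarrow> (\<forall>i j. ennreal (g i) + ennreal (h j) \<le> c)"
proof -
  have "pos_sup g + pos_sup h = (SUP i. ennreal (g i) + pos_sup h)"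
    unfolding pos_sup_def[of g] by (rule ennreal_SUP_add_left[symmetric]) auto
  also have "\<dots> = (SUP i. SUP j. ennreal (g i) + ennreal (h j))"
    unfolding pos_sup_def[of h] by (intro SUP_cong refl ennreal_SUP_add_right) auto
  finally show ?thesis by (simp add: SUP_le_iff)
qed

text \<open>Truncation at 0 makes the coercion subadditive instead of additive when signs are
  mixed.\<close>

lemma ennreal_add_le: "ennreal (x + y) \<le> ennreal x + ennreal y"
proof (cases "0 \<le> x \<and> 0 \<le> y")
  case False
  then consider "x < 0" | "y < 0" by linarith
  then show ?thesis
    by cases (auto simp: ennreal_neg intro: ennreal_leI add_increasing add_increasing2)
qed simp

text \<open>One sign of the contraction principle. For a pair (i, j) only u i - u j enters, which is
  at most |l i - l j|; this modulus is the increment of \<open>l\<close> along (i, j) or along (j,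
  i), and both orders compete in the supremum on the right.\<close>

lemma pos_sup_contraction:
  assumes 0: "g 0 = 0" "u 0 = 0" "l 0 = 0" and ul: "\<And>i j. \<bar>u i - u j\<bar> \<le> \<bar>l i - l j\<bar>"
  shows "pos_sup (\<lambda>i. g i + u i) + pos_sup (\<lambda>i. g i - u i)
    \<le> pos_sup (\<lambda>i. g i + l i) + pos_sup (\<lambda>i. g i - l i)"
  unfolding pos_sup_add_le_iff
proof (intro allI)
  have le: "ennreal (g i + l i) + ennreal (g j - l j)
      \<le> pos_sup (\<lambda>i. g i + l i) + pos_sup (\<lambda>i. g i - l i)" for i j
    by (rule pos_sup_add_le_iff[THEN iffD1, OF order_refl, rule_format])
  have nn: "ennreal (g i + u i) + ennreal (g j - u j)
      \<le> pos_sup (\<lambda>i. g i + l i) + pos_sup (\<lambda>i. g i - l i)"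
    if "0 \<le> g i + u i" "0 \<le> g j - u j" for i j
  proof -
    have "ennreal (g i + u i) + ennreal (g j - u j) = ennreal ((g i + u i) + (g j - u j))"
      using that by simp
    also have "\<dots> \<le> ennreal (g i + g j + \<bar>l i - l j\<bar>)"
      using ul[of i j] by (intro ennreal_leI) linarith
    also have "\<dots> \<le> pos_sup (\<lambda>i. g i + l i) + pos_sup (\<lambda>i. g i - l i)"
    proof (cases "l j \<le> l i")
      case True
      then have "ennreal (g i + g j + \<bar>l i - l j\<bar>) = ennreal ((g i + l i) + (g j - l j))"
        by (simp add: algebra_simps)
      also have "\<dots> \<le> ennreal (g i + l i) + ennreal (g j - l j)"
        by (rule ennreal_add_le)
      finally show ?thesis by (rule order_trans[OF _ le])
    next
      case False
      then have "ennreal (g i + g j + \<bar>l i - l j\<bar>) = ennreal ((g j + l j) + (g i - l i))"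
        by (simp add: algebra_simps)
      also have "\<dots> \<le> ennreal (g j + l j) + ennreal (g i - l i)"
        by (rule ennreal_add_le)
      finally show ?thesis by (rule order_trans[OF _ le])
    qed
    finally show ?thesis .
  qed
  fix i j
  \<comment> \<open>An index whose value is negative is moved to 0, where the value is 0; truncation
    sees no difference, and \<open>nn\<close> becomes applicable.\<close>
  define i' j' where "i' = (if 0 \<le> g i + u i then i else 0)" and "j' = (if 0 \<le> g j - u j then j else 0)"
  have "ennreal (g i + u i) + ennreal (g j - u j) = ennreal (g i' + u i') + ennreal (g j' - u j')"
    by (simp add: i'_def j'_def 0 ennreal_neg)
  also have "\<dots> \<le> pos_sup (\<lambda>i. g i + l i) + pos_sup (\<lambda>i. g i - l i)"
    by (rule nn) (simp_all add: i'_def j'_def 0)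
  finally show "ennreal (g i + u i) + ennreal (g j - u j)
      \<le> pos_sup (\<lambda>i. g i + l i) + pos_sup (\<lambda>i. g i - l i)" .
qed

section \<open>Sums of independent copies as iterated integrals\<close>

text \<open>The expectation of \<Phi> at \<open>g\<close> plus k independent copies of
  \<open>X\<close>, written as single integrals so that each summand can be symmetrized on its
  own.\<close>

primrec walk :: "'o measure \<Rightarrow> ('o \<Rightarrow> nat \<Rightarrow> real) \<Rightarrow> ((nat \<Rightarrow> real) \<Rightarrow> ennreal) \<Rightarrow> nat \<Rightarrow>
    (nat \<Rightarrow> real) \<Rightarrow> ennreal" where
  "walk \<mu> X \<Phi> 0 g = \<Phi> g"
| "walk \<mu> X \<Phi> (Suc k) g = (\<integral>\<^sup>+\<omega>. walk \<mu> X \<Phi> k (\<lambda>i. g i + X \<omega> i) \<partial>\<mu>)"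

text \<open>Fubini splits off one coordinate at a time. All factors are equal, so only the
  cardinality of the index set survives; the start \<open>g\<close> has to vary because it absorbs
  the coordinate split off.\<close>

lemma (in prob_space) nn_integral_PiM_eq_walk:
  assumes X [measurable]: "\<And>i. (\<lambda>\<omega>. X \<omega> i) \<in> borel_measurable M"
    and \<Phi>: "\<Phi> \<in> borel_measurable seq_space" and I: "finite I"
  shows "(\<integral>\<^sup>+\<omega>. \<Phi> (\<lambda>i. g i + (\<Sum>k\<in>I. X (\<omega> k) i)) \<partial>PiM I (\<lambda>_. M)) = walk M X \<Phi> (card I) g"
  using I
proof (induction I arbitrary: g)
  case empty
  show ?case by (simp add: PiM_empty nn_integral_count_space_finite)
next
  case (insert j I)
  interpret product_sigma_finite "\<lambda>_. M" by standard
  have "(\<lambda>\<omega>. \<Phi> (\<lambda>i. g i + (\<Sum>k\<in>insert j I. X (\<omega> k) i))) \<in> borel_measurable (PiM (insert j I) (\<lambda>_. M))"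
    by (rule measurable_compose[OF measurable_seq_spaceI \<Phi>]) measurable
  then have "(\<integral>\<^sup>+\<omega>. \<Phi> (\<lambda>i. g i + (\<Sum>k\<in>insert j I. X (\<omega> k) i)) \<partial>PiM (insert j I) (\<lambda>_. M))
      = (\<integral>\<^sup>+y. \<integral>\<^sup>+x. \<Phi> (\<lambda>i. g i + (\<Sum>k\<in>insert j I. X ((x(j := y)) k) i)) \<partial>PiM I (\<lambda>_. M) \<partial>M)"
    using insert.hyps by (intro product_nn_integral_insert_rev) auto
  also have "\<dots> = (\<integral>\<^sup>+y. \<integral>\<^sup>+\<omega>. \<Phi> (\<lambda>i. (g i + X y i) + (\<Sum>k\<in>I. X (\<omega> k) i)) \<partial>PiM I (\<lambda>_. M) \<partial>M)"
  proof -
    have "(\<Sum>k\<in>insert j I. X ((x(j := y)) k) i) = X y i + (\<Sum>k\<in>I. X (x k) i)" for x y i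
    proof -
      have "(\<Sum>k\<in>I. X ((x(j := y)) k) i) = (\<Sum>k\<in>I. X (x k) i)"
        using insert.hyps by (intro sum.cong) auto
      then show ?thesis using insert.hyps by simp
    qed
    then show ?thesis by (simp only: add.assoc)
  qed
  also have "\<dots> = walk M X \<Phi> (card (insert j I)) g"
    using insert.hyps by (simp add: insert.IH)
  finally show ?case .
qed

text \<open>Jensen for the square root through its tangent line, sqrt h <= h / (2 s) + s / 2. The
  best s is sqrt c; it is enlarged by e since c may be 0.\<close>

lemma (in prob_space) nn_integral_sqrt_le:
  assumes [measurable]: "h \<in> borel_measurable M" and h: "\<And>x. 0 \<le> h x"
    and c: "(\<integral>\<^sup>+x. ennreal (h x) \<partial>M) \<le> ennreal c" "0 \<le> c"
  shows "(\<integral>\<^sup>+x. ennreal (sqrt (h x)) \<partial>M) \<le> ennreal (sqrt c)"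
proof (rule ennreal_le_epsilon)
  fix e :: real assume e: "0 < e"
  define s where "s = sqrt c + e"
  have s: "0 < s" "c \<le> s\<^sup>2"
  proof -
    show "0 < s" using e c(2) by (simp add: s_def add_nonneg_pos)
    have "(sqrt c)\<^sup>2 \<le> s\<^sup>2" using e c(2) by (intro power_mono) (auto simp: s_def)
    then show "c \<le> s\<^sup>2" using c(2) by simp
  qed
  have "sqrt (h x) \<le> h x / (2 * s) + s / 2" for x
  proof -
    have "0 \<le> (sqrt (h x) - s)\<^sup>2" by simp
    then have "2 * s * sqrt (h x) \<le> h x + s\<^sup>2"
      using h[of x] by (simp add: power2_diff mult_ac)
    then show ?thesis using s by (simp add: field_simps power2_eq_square)
  qed
  then have "(\<integral>\<^sup>+x. ennreal (sqrt (h x)) \<partial>M) \<le> (\<integral>\<^sup>+x. ennreal (1 / (2 * s)) * ennreal (h x) + ennreal (s / 2) \<partial>M)"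
    using s h by (intro nn_integral_mono) (simp flip: ennreal_mult ennreal_plus)
  also have "\<dots> = ennreal (1 / (2 * s)) * (\<integral>\<^sup>+x. ennreal (h x) \<partial>M) + ennreal (s / 2)"
    by (simp add: nn_integral_add nn_integral_cmult emeasure_space_1)
  also have "\<dots> \<le> ennreal (1 / (2 * s)) * ennreal c + ennreal (s / 2)"
    using c by (intro add_mono mult_left_mono) auto
  also have "\<dots> = ennreal (c / (2 * s) + s / 2)"
    using s c by (simp flip: ennreal_mult ennreal_plus)
  also have "\<dots> \<le> ennreal s"
    using s by (intro ennreal_leI) (simp add: field_simps power2_eq_square)
  also have "\<dots> = ennreal (sqrt c) + ennreal e"
    using e c by (simp add: s_def)
  finally show "(\<integral>\<^sup>+x. ennreal (sqrt (h x)) \<partial>M) \<le> ennreal (sqrt c) + ennreal e" .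
qed

text \<open>Additivity of the variance for independent summands. The scalar sum is encoded as a
  constant sequence and read off at index 0, so that \<open>walk\<close> applies.\<close>

lemma (in prob_space) nn_integral_sum_square_le:
  assumes Y: "integrable M Y" and Y2: "integrable M (\<lambda>\<omega>. (Y \<omega>)\<^sup>2)" and I: "finite I"
  shows "(\<integral>\<^sup>+\<omega>. ennreal ((\<Sum>k\<in>I. Y (\<omega> k) - expectation Y)\<^sup>2) \<partial>PiM I (\<lambda>_. M))
    \<le> ennreal (real (card I) * expectation (\<lambda>\<omega>. (Y \<omega>)\<^sup>2))"
proof -
  define m v where "m = expectation Y" and "v = expectation (\<lambda>\<omega>. (Y \<omega>)\<^sup>2)"
  have v: "0 \<le> v" by (simp add: v_def)
  have [measurable]: "Y \<in> borel_measurable M" using Y by simp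
  have "walk M (\<lambda>\<omega> i. Y \<omega> - m) (\<lambda>g. ennreal ((g 0)\<^sup>2)) k g \<le> ennreal ((g 0)\<^sup>2 + real k * v)" for k g
  proof (induction k arbitrary: g)
    case (Suc k)
    define c where "c = g 0"
    have e: "(c + (Y \<omega> - m))\<^sup>2 + k * v
        = (Y \<omega>)\<^sup>2 + (2 * (c - m)) * Y \<omega> + ((c - m)\<^sup>2 + k * v)" for \<omega>
      by (simp add: power2_eq_square algebra_simps)
    have i: "integrable M (\<lambda>\<omega>. (c + (Y \<omega> - m))\<^sup>2 + k * v)"
      unfolding e using Y Y2 by auto
    have "walk M (\<lambda>\<omega> i. Y \<omega> - m) (\<lambda>g. ennreal ((g 0)\<^sup>2)) (Suc k) g
        \<le> (\<integral>\<^sup>+\<omega>. ennreal ((c + (Y \<omega> - m))\<^sup>2 + k * v) \<partial>M)"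
      unfolding walk.simps c_def by (intro nn_integral_mono Suc.IH)
    also have "\<dots> = ennreal (expectation (\<lambda>\<omega>. (c + (Y \<omega> - m))\<^sup>2 + k * v))"
      using i v by (intro nn_integral_eq_integral) auto
    also have "expectation (\<lambda>\<omega>. (c + (Y \<omega> - m))\<^sup>2 + k * v) = v + (2 * (c - m)) * m + ((c - m)\<^sup>2 + k * v)"
      unfolding e using Y Y2 by (simp add: m_def v_def prob_space)
    \<comment> \<open>The left side is c^2 + (k + 1) v - m^2: the cross terms in c cancel by
      centring, and dropping m^2 bounds the variance by the second moment.\<close>
    also have "\<dots> \<le> c\<^sup>2 + real (Suc k) * v"
      by (simp add: power2_eq_square algebra_simps)
    finally show ?case by (simp add: c_def ennreal_leI)
  qed simp
  from this[of "card I" "\<lambda>_. 0"] show ?thesis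
    using nn_integral_PiM_eq_walk[of "\<lambda>\<omega> i. Y \<omega> - m" "\<lambda>g. ennreal ((g 0)\<^sup>2)" I "\<lambda>_. 0"] I
    by (simp add: m_def v_def)
qed

section \<open>Processes with dominated increments\<close>

text \<open>Domination concerns increments, not values: this is the Lipschitz condition that
  contraction asks for. It is pointwise in the sample, so that it can be applied under the integral.
  Index 0 is the common zero of both processes.\<close>

locale dominated_process = prob_space \<mu> for \<mu> :: "'o measure" +
  fixes Z L :: "'o \<Rightarrow> nat \<Rightarrow> real"
  assumes L_measurable [measurable]: "\<And>i. (\<lambda>\<omega>. L \<omega> i) \<in> borel_measurable \<mu>"
    and Z_integrable: "\<And>i. integrable \<mu> (\<lambda>\<omega>. Z \<omega> i)"
    and dominated: "\<And>\<omega> i j. \<bar>Z \<omega> i - Z \<omega> j\<bar> \<le> \<bar>L \<omega> i - L \<omega> j\<bar>"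
    and Z_0 [simp]: "\<And>\<omega>. Z \<omega> 0 = 0" and L_0 [simp]: "\<And>\<omega>. L \<omega> 0 = 0"
begin

lemma Z_measurable [measurable]: "(\<lambda>\<omega>. Z \<omega> i) \<in> borel_measurable \<mu>"
  using Z_integrable by simp

definition mean :: "nat \<Rightarrow> real" where
  "mean i = expectation (\<lambda>\<omega>. Z \<omega> i)"

text \<open>The invariant of the symmetrization: after measurability, Jensen for replacing the mean
  by an independent copy of \<open>Z\<close>, midpoint convexity for separating the two copies, and
  contraction for passing from \<open>Z\<close> to \<open>L\<close>. Jensen is a clause of its own
  because on a sequence space convexity does not imply it for a mean taken coordinate by
  coordinate.\<close>

definition tame :: "((nat \<Rightarrow> real) \<Rightarrow> ennreal) \<Rightarrow> bool" where
  "tame \<Phi> \<longleftrightarrow> \<Phi> \<in> borel_measurable seq_space \<and>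
    (\<forall>g. \<Phi> (\<lambda>i. g i - mean i) \<le> (\<integral>\<^sup>+\<omega>. \<Phi> (\<lambda>i. g i - Z \<omega> i) \<partial>\<mu>)) \<and>
    (\<forall>u v. \<Phi> (\<lambda>i. (u i + v i) / 2) \<le> ennreal (1/2) * (\<Phi> u + \<Phi> v)) \<and>
    (\<forall>g u l. g 0 = 0 \<longrightarrow> u 0 = 0 \<longrightarrow> l 0 = 0 \<longrightarrow> (\<forall>i j. \<bar>u i - u j\<bar> \<le> \<bar>l i - l j\<bar>) \<longrightarrow>
      \<Phi> (\<lambda>i. g i + u i) + \<Phi> (\<lambda>i. g i - u i) \<le> \<Phi> (\<lambda>i. g i + l i) + \<Phi> (\<lambda>i. g i - l i))"

text \<open>The expectation of \<Phi> at g + 2 \<epsilon> L with a fair sign \<epsilon> independent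
  of \<open>L\<close>. The 2 is the price of separating the two copies by convexity.\<close>

definition sym_step :: "((nat \<Rightarrow> real) \<Rightarrow> ennreal) \<Rightarrow> (nat \<Rightarrow> real) \<Rightarrow> ennreal" where
  "sym_step \<Phi> g = (\<integral>\<^sup>+\<omega>. ennreal (1/2) *
    (\<Phi> (\<lambda>i. g i + 2 * L \<omega> i) + \<Phi> (\<lambda>i. g i - 2 * L \<omega> i)) \<partial>\<mu>)"

lemma half_double: "ennreal (1/2) * (x + x) = x"
proof -
  have "ennreal (1/2) * 2 = 1"
    by (subst ennreal_numeral[symmetric], subst ennreal_mult[symmetric]) simp_all
  then show ?thesis by (metis mult.assoc mult_1 mult_2)
qed

text \<open>Each clause is checked on coordinates before the supremum is taken. For Jensen the
  positive part is inserted under the integral, because the nonnegative integral of the coerced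
  function is the expectation of that positive part.\<close>

lemma tame_pos_sup: "tame pos_sup"
  unfolding tame_def
proof (intro conjI allI impI)
  fix g
  show "pos_sup (\<lambda>i. g i - mean i) \<le> (\<integral>\<^sup>+\<omega>. pos_sup (\<lambda>i. g i - Z \<omega> i) \<partial>\<mu>)"
    unfolding pos_sup_def[of "\<lambda>i. g i - mean i"]
  proof (rule SUP_least)
    fix i
    have "ennreal (g i - mean i) = ennreal (expectation (\<lambda>\<omega>. g i - Z \<omega> i))"
      using Z_integrable by (simp add: mean_def prob_space)
    also have "\<dots> \<le> ennreal (expectation (\<lambda>\<omega>. max 0 (g i - Z \<omega> i)))"
      using Z_integrable by (intro ennreal_leI integral_mono) auto
    also have "\<dots> = (\<integral>\<^sup>+\<omega>. ennreal (max 0 (g i - Z \<omega> i)) \<partial>\<mu>)"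
      using Z_integrable by (intro nn_integral_eq_integral[symmetric]) auto
    also have "\<dots> \<le> (\<integral>\<^sup>+\<omega>. pos_sup (\<lambda>i. g i - Z \<omega> i) \<partial>\<mu>)"
      by (intro nn_integral_mono) (auto simp: pos_sup_def ennreal_max_0 intro: SUP_upper)
    finally show "ennreal (g i - mean i) \<le> (\<integral>\<^sup>+\<omega>. pos_sup (\<lambda>i. g i - Z \<omega> i) \<partial>\<mu>)" .
  qed
next
  fix u v
  show "pos_sup (\<lambda>i. (u i + v i) / 2) \<le> ennreal (1/2) * (pos_sup u + pos_sup v)"
    unfolding pos_sup_def[of "\<lambda>i. (u i + v i) / 2"]
  proof (rule SUP_least)
    fix i
    have "ennreal ((u i + v i) / 2) = ennreal (1/2) * ennreal (u i + v i)"
      by (subst ennreal_mult'[symmetric]) simp_all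
    also have "\<dots> \<le> ennreal (1/2) * (ennreal (u i) + ennreal (v i))"
      by (intro mult_left_mono ennreal_add_le) simp
    also have "\<dots> \<le> ennreal (1/2) * (pos_sup u + pos_sup v)"
      by (intro mult_left_mono add_mono) (auto simp: pos_sup_def intro: SUP_upper)
    finally show "ennreal ((u i + v i) / 2) \<le> ennreal (1/2) * (pos_sup u + pos_sup v)" .
  qed
qed (auto intro: pos_sup_contraction)

text \<open>\<open>sym_step\<close> averages translates of \<Phi>, and the clauses are stable under
  translation and averaging. For Jensen the two averages are exchanged by Fubini; for contraction it
  matters that the shifts vanish at index 0.\<close>

lemma tame_sym_step:
  assumes "tame \<Phi>"
  shows "tame (sym_step \<Phi>)"
proof -
  interpret pair_sigma_finite \<mu> \<mu> ..
  from assms have \<Phi>: "\<Phi> \<in> borel_measurable seq_space"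
    and jensen: "\<And>g. \<Phi> (\<lambda>i. g i - mean i) \<le> (\<integral>\<^sup>+\<omega>. \<Phi> (\<lambda>i. g i - Z \<omega> i) \<partial>\<mu>)"
    and convex: "\<And>u v. \<Phi> (\<lambda>i. (u i + v i) / 2) \<le> ennreal (1/2) * (\<Phi> u + \<Phi> v)"
    and contr: "\<And>g u l. \<lbrakk>g 0 = 0; u 0 = 0; l 0 = 0; \<And>i j. \<bar>u i - u j\<bar> \<le> \<bar>l i - l j\<bar>\<rbrakk> \<Longrightarrow>
      \<Phi> (\<lambda>i. g i + u i) + \<Phi> (\<lambda>i. g i - u i) \<le> \<Phi> (\<lambda>i. g i + l i) + \<Phi> (\<lambda>i. g i - l i)"
    unfolding tame_def by blast+
  note meas = measurable_compose[OF measurable_seq_spaceI \<Phi>]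
  show ?thesis
    unfolding tame_def
  proof (intro conjI allI impI)
    have [measurable]: "(\<lambda>(g, \<omega>). \<Phi> (\<lambda>i. g i + 2 * L \<omega> i)) \<in> borel_measurable (seq_space \<Otimes>\<^sub>M \<mu>)"
      "(\<lambda>(g, \<omega>). \<Phi> (\<lambda>i. g i - 2 * L \<omega> i)) \<in> borel_measurable (seq_space \<Otimes>\<^sub>M \<mu>)"
      unfolding split_beta by (rule meas; measurable)+
    show "sym_step \<Phi> \<in> borel_measurable seq_space"
      unfolding sym_step_def[abs_def] by measurable
  next
    fix g
    have m1: "(\<lambda>\<omega>. \<Phi> (\<lambda>i. w i - Z \<omega> i)) \<in> borel_measurable \<mu>" for w
      by (rule meas) measurable
    have [measurable]: "(\<lambda>(\<omega>, \<omega>'). \<Phi> (\<lambda>i. g i + 2 * L \<omega> i - Z \<omega>' i)) \<in> borel_measurable (\<mu> \<Otimes>\<^sub>M \<mu>)"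
      "(\<lambda>(\<omega>, \<omega>'). \<Phi> (\<lambda>i. g i - 2 * L \<omega> i - Z \<omega>' i)) \<in> borel_measurable (\<mu> \<Otimes>\<^sub>M \<mu>)"
      unfolding split_beta by (rule meas; measurable)+
    have "sym_step \<Phi> (\<lambda>i. g i - mean i) = (\<integral>\<^sup>+\<omega>. ennreal (1/2) *
        (\<Phi> (\<lambda>i. (g i + 2 * L \<omega> i) - mean i) + \<Phi> (\<lambda>i. (g i - 2 * L \<omega> i) - mean i)) \<partial>\<mu>)"
      by (simp add: sym_step_def algebra_simps)
    also have "\<dots> \<le> (\<integral>\<^sup>+\<omega>. ennreal (1/2) *
        ((\<integral>\<^sup>+\<omega>'. \<Phi> (\<lambda>i. (g i + 2 * L \<omega> i) - Z \<omega>' i) \<partial>\<mu>) + (\<integral>\<^sup>+\<omega>'. \<Phi> (\<lambda>i. (g i - 2 * L \<omega> i) - Z \<omega>' i) \<partial>\<mu>)) \<partial>\<mu>)"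
      by (intro nn_integral_mono mult_left_mono add_mono jensen) auto
    also have "\<dots> = (\<integral>\<^sup>+\<omega>. \<integral>\<^sup>+\<omega>'. ennreal (1/2) *
        (\<Phi> (\<lambda>i. g i + 2 * L \<omega> i - Z \<omega>' i) + \<Phi> (\<lambda>i. g i - 2 * L \<omega> i - Z \<omega>' i)) \<partial>\<mu> \<partial>\<mu>)"
    proof (rule nn_integral_cong)
      fix \<omega>
      show "ennreal (1/2) * ((\<integral>\<^sup>+\<omega>'. \<Phi> (\<lambda>i. (g i + 2 * L \<omega> i) - Z \<omega>' i) \<partial>\<mu>) +
            (\<integral>\<^sup>+\<omega>'. \<Phi> (\<lambda>i. (g i - 2 * L \<omega> i) - Z \<omega>' i) \<partial>\<mu>))
          = (\<integral>\<^sup>+\<omega>'. ennreal (1/2) *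
            (\<Phi> (\<lambda>i. g i + 2 * L \<omega> i - Z \<omega>' i) + \<Phi> (\<lambda>i. g i - 2 * L \<omega> i - Z \<omega>' i)) \<partial>\<mu>)"
        using m1[of "\<lambda>i. g i + 2 * L \<omega> i"] m1[of "\<lambda>i. g i - 2 * L \<omega> i"]
        by (simp add: nn_integral_add nn_integral_cmult)
    qed
    also have "\<dots> = (\<integral>\<^sup>+\<omega>'. \<integral>\<^sup>+\<omega>. ennreal (1/2) *
        (\<Phi> (\<lambda>i. g i + 2 * L \<omega> i - Z \<omega>' i) + \<Phi> (\<lambda>i. g i - 2 * L \<omega> i - Z \<omega>' i)) \<partial>\<mu> \<partial>\<mu>)"
      by (rule Fubini'[symmetric]) measurable
    also have "\<dots> = (\<integral>\<^sup>+\<omega>'. sym_step \<Phi> (\<lambda>i. g i - Z \<omega>' i) \<partial>\<mu>)"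
      by (simp add: sym_step_def algebra_simps)
    finally show "sym_step \<Phi> (\<lambda>i. g i - mean i) \<le> (\<integral>\<^sup>+\<omega>. sym_step \<Phi> (\<lambda>i. g i - Z \<omega> i) \<partial>\<mu>)" .
  next
    fix u v :: "nat \<Rightarrow> real"
    have [measurable]: "(\<lambda>\<omega>. \<Phi> (\<lambda>i. w i + 2 * L \<omega> i)) \<in> borel_measurable \<mu>"
      "(\<lambda>\<omega>. \<Phi> (\<lambda>i. w i - 2 * L \<omega> i)) \<in> borel_measurable \<mu>" for w
      by (rule meas; measurable)+
    have "sym_step \<Phi> (\<lambda>i. (u i + v i) / 2) \<le> (\<integral>\<^sup>+\<omega>. ennreal (1/2) *
        (ennreal (1/2) * (\<Phi> (\<lambda>i. u i + 2 * L \<omega> i) + \<Phi> (\<lambda>i. v i + 2 * L \<omega> i)) +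
         ennreal (1/2) * (\<Phi> (\<lambda>i. u i - 2 * L \<omega> i) + \<Phi> (\<lambda>i. v i - 2 * L \<omega> i))) \<partial>\<mu>)"
      unfolding sym_step_def
    proof (intro nn_integral_mono mult_left_mono add_mono)
      fix \<omega>
      have "(\<lambda>i. (u i + v i) / 2 + 2 * L \<omega> i) = (\<lambda>i. ((u i + 2 * L \<omega> i) + (v i + 2 * L \<omega> i)) / 2)"
        "(\<lambda>i. (u i + v i) / 2 - 2 * L \<omega> i) = (\<lambda>i. ((u i - 2 * L \<omega> i) + (v i - 2 * L \<omega> i)) / 2)"
        by (auto simp: field_simps)
      then show "\<Phi> (\<lambda>i. (u i + v i) / 2 + 2 * L \<omega> i)
          \<le> ennreal (1/2) * (\<Phi> (\<lambda>i. u i + 2 * L \<omega> i) + \<Phi> (\<lambda>i. v i + 2 * L \<omega> i))"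
        "\<Phi> (\<lambda>i. (u i + v i) / 2 - 2 * L \<omega> i)
          \<le> ennreal (1/2) * (\<Phi> (\<lambda>i. u i - 2 * L \<omega> i) + \<Phi> (\<lambda>i. v i - 2 * L \<omega> i))"
        by (auto simp only: convex)
    qed auto
    also have "\<dots> = (\<integral>\<^sup>+\<omega>. ennreal (1/2) *
        (ennreal (1/2) * (\<Phi> (\<lambda>i. u i + 2 * L \<omega> i) + \<Phi> (\<lambda>i. u i - 2 * L \<omega> i)) +
         ennreal (1/2) * (\<Phi> (\<lambda>i. v i + 2 * L \<omega> i) + \<Phi> (\<lambda>i. v i - 2 * L \<omega> i))) \<partial>\<mu>)"
      by (simp only: distrib_left add_ac)
    also have "\<dots> = ennreal (1/2) * (sym_step \<Phi> u + sym_step \<Phi> v)"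
      unfolding sym_step_def by (subst nn_integral_cmult, measurable, subst nn_integral_add, measurable)
    finally show "sym_step \<Phi> (\<lambda>i. (u i + v i) / 2) \<le> ennreal (1/2) * (sym_step \<Phi> u + sym_step \<Phi> v)" .
  next
    fix g u l :: "nat \<Rightarrow> real"
    assume 0: "g 0 = 0" "u 0 = 0" "l 0 = 0" and ul: "\<forall>i j. \<bar>u i - u j\<bar> \<le> \<bar>l i - l j\<bar>"
    have [measurable]: "(\<lambda>\<omega>. \<Phi> (\<lambda>i. w i + 2 * L \<omega> i)) \<in> borel_measurable \<mu>"
      "(\<lambda>\<omega>. \<Phi> (\<lambda>i. w i - 2 * L \<omega> i)) \<in> borel_measurable \<mu>" for w
      by (rule meas; measurable)+
    \<comment> \<open>The four terms are regrouped by the sign of \<open>L\<close>, so that each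
      group is a contraction pair around a shifted base point.\<close>
    have sum: "sym_step \<Phi> (\<lambda>i. g i + w i) + sym_step \<Phi> (\<lambda>i. g i - w i)
        = (\<integral>\<^sup>+\<omega>. ennreal (1/2) *
          ((\<Phi> (\<lambda>i. (g i + 2 * L \<omega> i) + w i) + \<Phi> (\<lambda>i. (g i + 2 * L \<omega> i) - w i)) +
           (\<Phi> (\<lambda>i. (g i - 2 * L \<omega> i) + w i) + \<Phi> (\<lambda>i. (g i - 2 * L \<omega> i) - w i))) \<partial>\<mu>)" for w
    proof -
      have "sym_step \<Phi> (\<lambda>i. g i + w i) + sym_step \<Phi> (\<lambda>i. g i - w i)
        = (\<integral>\<^sup>+\<omega>. ennreal (1/2) * (\<Phi> (\<lambda>i. g i + w i + 2 * L \<omega> i) + \<Phi> (\<lambda>i. g i + w i - 2 * L \<omega> i)) +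
            ennreal (1/2) * (\<Phi> (\<lambda>i. g i - w i + 2 * L \<omega> i) + \<Phi> (\<lambda>i. g i - w i - 2 * L \<omega> i)) \<partial>\<mu>)"
        unfolding sym_step_def by (rule nn_integral_add[symmetric]) measurable
      moreover have "(\<lambda>i. g i + w i + 2 * L \<omega> i) = (\<lambda>i. (g i + 2 * L \<omega> i) + w i)"
        "(\<lambda>i. g i + w i - 2 * L \<omega> i) = (\<lambda>i. (g i - 2 * L \<omega> i) + w i)"
        "(\<lambda>i. g i - w i + 2 * L \<omega> i) = (\<lambda>i. (g i + 2 * L \<omega> i) - w i)"
        "(\<lambda>i. g i - w i - 2 * L \<omega> i) = (\<lambda>i. (g i - 2 * L \<omega> i) - w i)" for \<omega>
        by auto
      ultimately show ?thesis
        by (simp only: distrib_left add_ac)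
    qed
    show "sym_step \<Phi> (\<lambda>i. g i + u i) + sym_step \<Phi> (\<lambda>i. g i - u i)
        \<le> sym_step \<Phi> (\<lambda>i. g i + l i) + sym_step \<Phi> (\<lambda>i. g i - l i)"
      unfolding sum using 0 ul
      by (intro nn_integral_mono mult_left_mono add_mono contr) auto
  qed
qed

lemma tame_funpow_sym_step: "tame ((sym_step ^^ k) pos_sup)"
  by (induction k) (simp_all add: tame_pos_sup tame_sym_step)

lemma mean_0 [simp]: "mean 0 = 0"
  by (simp add: mean_def)

text \<open>Symmetrization and contraction are done for one summand at a time. Convexity replaces
  \<open>Z \<omega> - Z \<omega>'\<close> by \<open>2 * Z \<omega>\<close> and \<open>- 2 * Z \<omega>'\<close> with equal weights, which is where the random
  sign comes from.\<close>

lemma walk_le_sym_step: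
  assumes "g 0 = 0"
  shows "walk \<mu> (\<lambda>\<omega> i. Z \<omega> i - mean i) pos_sup k g \<le> (sym_step ^^ k) pos_sup g"
  using assms
proof (induction k arbitrary: g)
  case (Suc k)
  define \<Phi> where "\<Phi> = (sym_step ^^ k) pos_sup"
  have "tame \<Phi>" unfolding \<Phi>_def by (rule tame_funpow_sym_step)
  then have \<Phi>: "\<Phi> \<in> borel_measurable seq_space"
    and jensen: "\<And>g. \<Phi> (\<lambda>i. g i - mean i) \<le> (\<integral>\<^sup>+\<omega>. \<Phi> (\<lambda>i. g i - Z \<omega> i) \<partial>\<mu>)"
    and convex: "\<And>u v. \<Phi> (\<lambda>i. (u i + v i) / 2) \<le> ennreal (1/2) * (\<Phi> u + \<Phi> v)"
    and contr: "\<And>g u l. \<lbrakk>g 0 = 0; u 0 = 0; l 0 = 0; \<And>i j. \<bar>u i - u j\<bar> \<le> \<bar>l i - l j\<bar>\<rbrakk> \<Longrightarrow>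
      \<Phi> (\<lambda>i. g i + u i) + \<Phi> (\<lambda>i. g i - u i) \<le> \<Phi> (\<lambda>i. g i + l i) + \<Phi> (\<lambda>i. g i - l i)"
    unfolding tame_def by blast+
  have [measurable]: "(\<lambda>\<omega>. \<Phi> (\<lambda>i. g i + 2 * Z \<omega> i)) \<in> borel_measurable \<mu>"
    "(\<lambda>\<omega>. \<Phi> (\<lambda>i. g i - 2 * Z \<omega> i)) \<in> borel_measurable \<mu>"
    by (rule measurable_compose[OF measurable_seq_spaceI \<Phi>]; measurable)+
  \<comment> \<open>The induction hypothesis is applied at a moved base point, which still vanishes
    at index 0.\<close>
  have "walk \<mu> (\<lambda>\<omega> i. Z \<omega> i - mean i) pos_sup (Suc k) g \<le> (\<integral>\<^sup>+\<omega>. \<Phi> (\<lambda>i. (g i + Z \<omega> i) - mean i) \<partial>\<mu>)"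
    using Suc.IH Suc.prems by (auto simp: \<Phi>_def add_diff_eq intro!: nn_integral_mono)
  also have "\<dots> \<le> (\<integral>\<^sup>+\<omega>. \<integral>\<^sup>+\<omega>'. \<Phi> (\<lambda>i. (g i + Z \<omega> i) - Z \<omega>' i) \<partial>\<mu> \<partial>\<mu>)"
    by (intro nn_integral_mono jensen)
  also have "\<dots> \<le> (\<integral>\<^sup>+\<omega>. \<integral>\<^sup>+\<omega>'. ennreal (1/2) * (\<Phi> (\<lambda>i. g i + 2 * Z \<omega> i) + \<Phi> (\<lambda>i. g i - 2 * Z \<omega>' i)) \<partial>\<mu> \<partial>\<mu>)"
  proof (intro nn_integral_mono)
    fix \<omega> \<omega>'
    have "(\<lambda>i. (g i + Z \<omega> i) - Z \<omega>' i) = (\<lambda>i. ((g i + 2 * Z \<omega> i) + (g i - 2 * Z \<omega>' i)) / 2)"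
      by auto
    then show "\<Phi> (\<lambda>i. (g i + Z \<omega> i) - Z \<omega>' i)
        \<le> ennreal (1/2) * (\<Phi> (\<lambda>i. g i + 2 * Z \<omega> i) + \<Phi> (\<lambda>i. g i - 2 * Z \<omega>' i))"
      by (simp only: convex)
  qed
  \<comment> \<open>Each term depends on one of the two copies only, and these have the same law, so
    the double integral collapses.\<close>
  also have "\<dots> = (\<integral>\<^sup>+\<omega>. ennreal (1/2) * (\<Phi> (\<lambda>i. g i + 2 * Z \<omega> i) + \<Phi> (\<lambda>i. g i - 2 * Z \<omega> i)) \<partial>\<mu>)"
    by (simp add: nn_integral_add nn_integral_cmult emeasure_space_1)
  also have "\<dots> \<le> sym_step \<Phi> g"
    unfolding sym_step_def
  proof (intro nn_integral_mono mult_left_mono)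
    fix \<omega>
    have "\<bar>2 * Z \<omega> i - 2 * Z \<omega> j\<bar> \<le> \<bar>2 * L \<omega> i - 2 * L \<omega> j\<bar>" for i j
      using dominated[of \<omega> i j] by linarith
    then show "\<Phi> (\<lambda>i. g i + 2 * Z \<omega> i) + \<Phi> (\<lambda>i. g i - 2 * Z \<omega> i)
        \<le> \<Phi> (\<lambda>i. g i + 2 * L \<omega> i) + \<Phi> (\<lambda>i. g i - 2 * L \<omega> i)"
      using Suc.prems by (intro contr) simp_all
  qed simp
  finally show ?case by (simp add: \<Phi>_def)
qed simp

text \<open>The bound has the form that one more step reproduces: averaging over the sign and then
  over \<open>a\<close> passes under the square root by concavity, and adds 2^2 s to the radicand.
  Cauchy-Schwarz starts the induction; the start \<open>v\<close> has to be arbitrary since it is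
  moved by the random step.\<close>

lemma sym_step_linear_le:
  fixes a :: "'o \<Rightarrow> 'e::euclidean_space"
  assumes L: "\<And>\<omega> i. L \<omega> i = inner (a \<omega>) (q i)" and [measurable]: "a \<in> borel_measurable \<mu>"
    and q: "\<And>i. norm (q i) \<le> r" and s: "(\<integral>\<^sup>+\<omega>. ennreal ((norm (a \<omega>))\<^sup>2) \<partial>\<mu>) \<le> ennreal s" "0 \<le> s"
  shows "(sym_step ^^ k) pos_sup (\<lambda>i. inner v (q i)) \<le> ennreal (r * sqrt ((norm v)\<^sup>2 + 4 * real k * s))"
proof (induction k arbitrary: v)
  case 0
  have "inner v (q i) \<le> r * sqrt ((norm v)\<^sup>2)" for i
  proof -
    have "inner v (q i) \<le> norm v * norm (q i)" by (rule norm_cauchy_schwarz)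
    also have "\<dots> \<le> norm v * r" by (intro mult_left_mono q) simp
    finally show ?thesis by (simp add: mult.commute)
  qed
  then show ?case
    by (auto simp: pos_sup_def intro!: SUP_least ennreal_leI)
next
  case (Suc k)
  have r: "0 \<le> r" using q[of 0] norm_ge_zero order_trans by blast
  define B where "B w = (norm w)\<^sup>2 + 4 * real k * s" for w :: 'e
  have B: "0 \<le> B w" for w using s by (simp add: B_def)
  \<comment> \<open>The parallelogram law: the random sign removes the cross term, although
    \<open>a\<close> is not centred.\<close>
  have B2: "(B (v + 2 *\<^sub>R a \<omega>) + B (v - 2 *\<^sub>R a \<omega>)) / 2 = B v + 4 * (norm (a \<omega>))\<^sup>2" for \<omega>
    by (simp add: B_def power2_norm_eq_inner inner_add_left inner_add_right inner_diff_left
        inner_diff_right inner_commute algebra_simps)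
  have avg: "(sqrt x + sqrt y) / 2 \<le> sqrt ((x + y) / 2)" if "0 \<le> x" "0 \<le> y" for x y :: real
  proof (rule real_le_rsqrt)
    have "0 \<le> (sqrt x - sqrt y)\<^sup>2" by simp
    then show "((sqrt x + sqrt y) / 2)\<^sup>2 \<le> (x + y) / 2"
      using that by (simp add: power2_sum power2_diff power_divide field_simps)
  qed
  have "(sym_step ^^ Suc k) pos_sup (\<lambda>i. inner v (q i)) = (\<integral>\<^sup>+\<omega>. ennreal (1/2) *
      ((sym_step ^^ k) pos_sup (\<lambda>i. inner (v + 2 *\<^sub>R a \<omega>) (q i)) +
       (sym_step ^^ k) pos_sup (\<lambda>i. inner (v - 2 *\<^sub>R a \<omega>) (q i))) \<partial>\<mu>)"
    by (simp add: sym_step_def L inner_add_left inner_diff_left)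
  also have "\<dots> \<le> (\<integral>\<^sup>+\<omega>. ennreal (1/2) * (ennreal (r * sqrt (B (v + 2 *\<^sub>R a \<omega>))) +
      ennreal (r * sqrt (B (v - 2 *\<^sub>R a \<omega>)))) \<partial>\<mu>)"
    unfolding B_def by (intro nn_integral_mono mult_left_mono add_mono Suc.IH) auto
  also have "\<dots> = (\<integral>\<^sup>+\<omega>. ennreal (r * ((sqrt (B (v + 2 *\<^sub>R a \<omega>)) + sqrt (B (v - 2 *\<^sub>R a \<omega>))) / 2)) \<partial>\<mu>)"
  proof (rule nn_integral_cong)
    fix \<omega>
    have "ennreal (r * sqrt (B (v + 2 *\<^sub>R a \<omega>))) + ennreal (r * sqrt (B (v - 2 *\<^sub>R a \<omega>)))
        = ennreal (r * sqrt (B (v + 2 *\<^sub>R a \<omega>)) + r * sqrt (B (v - 2 *\<^sub>R a \<omega>)))"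
      using r B by simp
    then show "ennreal (1/2) * (ennreal (r * sqrt (B (v + 2 *\<^sub>R a \<omega>))) + ennreal (r * sqrt (B (v - 2 *\<^sub>R a \<omega>))))
        = ennreal (r * ((sqrt (B (v + 2 *\<^sub>R a \<omega>)) + sqrt (B (v - 2 *\<^sub>R a \<omega>))) / 2))"
      by (simp only:, subst ennreal_mult'[symmetric]) (simp_all add: field_simps)
  qed
  also have "\<dots> \<le> (\<integral>\<^sup>+\<omega>. ennreal (r * sqrt (B v + 4 * (norm (a \<omega>))\<^sup>2)) \<partial>\<mu>)"
    unfolding B2[symmetric] using r B by (intro nn_integral_mono ennreal_leI mult_left_mono avg)
  also have "\<dots> = ennreal r * (\<integral>\<^sup>+\<omega>. ennreal (sqrt (B v + 4 * (norm (a \<omega>))\<^sup>2)) \<partial>\<mu>)"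
    using r B by (simp add: ennreal_mult nn_integral_cmult)
  also have "\<dots> \<le> ennreal r * ennreal (sqrt (B v + 4 * s))"
  proof (intro mult_left_mono nn_integral_sqrt_le)
    have "(\<integral>\<^sup>+\<omega>. ennreal (B v + 4 * (norm (a \<omega>))\<^sup>2) \<partial>\<mu>)
        = (\<integral>\<^sup>+\<omega>. ennreal (B v) + ennreal 4 * ennreal ((norm (a \<omega>))\<^sup>2) \<partial>\<mu>)"
      using B by (intro nn_integral_cong) (simp add: ennreal_plus ennreal_mult)
    also have "\<dots> = ennreal (B v) + ennreal 4 * (\<integral>\<^sup>+\<omega>. ennreal ((norm (a \<omega>))\<^sup>2) \<partial>\<mu>)"
      by (subst nn_integral_add, measurable, subst nn_integral_cmult, measurable)
        (simp add: emeasure_space_1)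
    also have "\<dots> \<le> ennreal (B v) + ennreal 4 * ennreal s"
      by (intro add_mono mult_left_mono s) auto
    also have "\<dots> = ennreal (B v + 4 * s)"
      using B s by (simp add: ennreal_plus ennreal_mult)
    finally show "(\<integral>\<^sup>+\<omega>. ennreal (B v + 4 * (norm (a \<omega>))\<^sup>2) \<partial>\<mu>) \<le> ennreal (B v + 4 * s)" .
  qed (use B s in auto)
  also have "\<dots> = ennreal (r * sqrt ((norm v)\<^sup>2 + 4 * real (Suc k) * s))"
    using r B s by (simp add: B_def algebra_simps flip: ennreal_mult)
  finally show ?case .
qed

lemma nn_integral_pos_sup_le:
  fixes a :: "'o \<Rightarrow> 'e::euclidean_space"
  assumes "\<And>\<omega> i. L \<omega> i = inner (a \<omega>) (q i)" "a \<in> borel_measurable \<mu>" "\<And>i. norm (q i) \<le> r"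
    and "(\<integral>\<^sup>+\<omega>. ennreal ((norm (a \<omega>))\<^sup>2) \<partial>\<mu>) \<le> ennreal s" "0 \<le> s" and I: "finite I"
  shows "(\<integral>\<^sup>+\<omega>. pos_sup (\<lambda>i. \<Sum>k\<in>I. Z (\<omega> k) i - mean i) \<partial>PiM I (\<lambda>_. \<mu>))
    \<le> ennreal (2 * r * sqrt (real (card I) * s))"
proof -
  have "(\<integral>\<^sup>+\<omega>. pos_sup (\<lambda>i. \<Sum>k\<in>I. Z (\<omega> k) i - mean i) \<partial>PiM I (\<lambda>_. \<mu>))
      = walk \<mu> (\<lambda>\<omega> i. Z \<omega> i - mean i) pos_sup (card I) (\<lambda>_. 0)"
    using nn_integral_PiM_eq_walk[of "\<lambda>\<omega> i. Z \<omega> i - mean i" pos_sup I "\<lambda>_. 0"] I by simp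
  also have "\<dots> \<le> (sym_step ^^ card I) pos_sup (\<lambda>i. inner 0 (q i))"
    using walk_le_sym_step[where g = "\<lambda>_. 0"] by simp
  also have "\<dots> \<le> ennreal (r * sqrt ((norm (0::'e))\<^sup>2 + 4 * real (card I) * s))"
    by (rule sym_step_linear_le[where a = a]) fact+
  also have "\<dots> = ennreal (2 * r * sqrt (real (card I) * s))"
    by (simp add: real_sqrt_mult mult_ac)
  finally show ?thesis .
qed

end

text \<open>The modulus is the sum of positive and negative part. The negated process is dominated
  by the same \<open>L\<close>, so the one-sided bound applies twice and the constant
  doubles.\<close>

lemma (in dominated_process) nn_integral_SUP_abs_le:
  fixes a :: "'o \<Rightarrow> 'e::euclidean_space"
  assumes a: "\<And>\<omega> i. L \<omega> i = inner (a \<omega>) (q i)" "a \<in> borel_measurable \<mu>" "\<And>i. norm (q i) \<le> r"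
    and s: "(\<integral>\<^sup>+\<omega>. ennreal ((norm (a \<omega>))\<^sup>2) \<partial>\<mu>) \<le> ennreal s" "0 \<le> s" and I: "finite I"
  shows "(\<integral>\<^sup>+\<omega>. (SUP i. ennreal \<bar>\<Sum>k\<in>I. Z (\<omega> k) i - mean i\<bar>) \<partial>PiM I (\<lambda>_. \<mu>))
    \<le> ennreal (4 * r * sqrt (real (card I) * s))"
proof -
  interpret neg: dominated_process \<mu> "\<lambda>\<omega> i. - Z \<omega> i" L
    using dominated by unfold_locales (auto simp: Z_integrable abs_minus_commute)
  have r: "0 \<le> r" using a(3)[of 0] norm_ge_zero order_trans by blast
  have nm: "neg.mean i = - mean i" for i
    by (simp add: neg.mean_def mean_def)
  have [measurable]: "(\<lambda>\<omega>. pos_sup (\<lambda>i. \<Sum>k\<in>I. Z (\<omega> k) i - mean i)) \<in> borel_measurable (PiM I (\<lambda>_. \<mu>))"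
    "(\<lambda>\<omega>. pos_sup (\<lambda>i. \<Sum>k\<in>I. - Z (\<omega> k) i - - mean i)) \<in> borel_measurable (PiM I (\<lambda>_. \<mu>))"
    by (rule measurable_compose[OF measurable_seq_spaceI pos_sup_measurable]; measurable)+
  have "(\<integral>\<^sup>+\<omega>. (SUP i. ennreal \<bar>\<Sum>k\<in>I. Z (\<omega> k) i - mean i\<bar>) \<partial>PiM I (\<lambda>_. \<mu>))
      \<le> (\<integral>\<^sup>+\<omega>. pos_sup (\<lambda>i. \<Sum>k\<in>I. Z (\<omega> k) i - mean i) +
            pos_sup (\<lambda>i. \<Sum>k\<in>I. - Z (\<omega> k) i - neg.mean i) \<partial>PiM I (\<lambda>_. \<mu>))"
  proof (intro nn_integral_mono SUP_least)
    fix \<omega> i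
    let ?t = "\<Sum>k\<in>I. Z (\<omega> k) i - mean i"
    have "ennreal \<bar>?t\<bar> \<le> ennreal ?t + ennreal (- ?t)"
      by (cases "0 \<le> ?t") (auto simp: ennreal_neg)
    also have "- ?t = (\<Sum>k\<in>I. - Z (\<omega> k) i - neg.mean i)"
      by (simp add: nm flip: sum_negf)
    finally show "ennreal \<bar>?t\<bar> \<le> pos_sup (\<lambda>i. \<Sum>k\<in>I. Z (\<omega> k) i - mean i) +
        pos_sup (\<lambda>i. \<Sum>k\<in>I. - Z (\<omega> k) i - neg.mean i)"
      unfolding pos_sup_def by (rule order_trans) (intro add_mono SUP_upper UNIV_I)
  qed
  also have "\<dots> = (\<integral>\<^sup>+\<omega>. pos_sup (\<lambda>i. \<Sum>k\<in>I. Z (\<omega> k) i - mean i) \<partial>PiM I (\<lambda>_. \<mu>)) +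
      (\<integral>\<^sup>+\<omega>. pos_sup (\<lambda>i. \<Sum>k\<in>I. - Z (\<omega> k) i - neg.mean i) \<partial>PiM I (\<lambda>_. \<mu>))"
    unfolding nm by (rule nn_integral_add) measurable
  also have "\<dots> \<le> ennreal (2 * r * sqrt (real (card I) * s)) + ennreal (2 * r * sqrt (real (card I) * s))"
    by (intro add_mono nn_integral_pos_sup_le[OF assms] neg.nn_integral_pos_sup_le[OF assms])
  also have "\<dots> = ennreal (4 * r * sqrt (real (card I) * s))"
    using r s by (simp flip: ennreal_plus)
  finally show ?thesis .
qed

section \<open>Law of the random parameters\<close>

text \<open>A \<open>pmf\<close> lives on the discrete sigma-algebra; pushing it forward along the
  identity gives a Borel measure, comparable with the law of a real random variable.\<close>

definition coin :: "real measure" where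
  "coin = distr (measure_pmf (pmf_of_set {0, 1})) borel (\<lambda>x. x)"

lemma sets_coin [simp, measurable_cong]: "sets coin = sets borel"
  by (simp add: coin_def)

lemma space_coin [simp]: "space coin = UNIV"
  by (simp add: coin_def)

lemma prob_space_coin: "prob_space coin"
  unfolding coin_def by (rule measure_pmf.prob_space_distr) simp

lemma nn_integral_coin:
  assumes [measurable]: "h \<in> borel_measurable borel"
  shows "(\<integral>\<^sup>+b. h b \<partial>coin) = (h 0 + h 1) / 2"
  by (simp add: coin_def nn_integral_distr nn_integral_pmf_of_set)

lemma integral_coin:
  fixes h :: "real \<Rightarrow> real"
  assumes [measurable]: "h \<in> borel_measurable borel"
  shows "(LINT b|coin. h b) = (h 0 + h 1) / 2"
  by (simp add: coin_def integral_distr integral_pmf_of_set)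

text \<open>The two events have total probability 1, so any event may be intersected with their
  union, and on each of them membership in \<open>E\<close> is constant.\<close>

lemma (in prob_space) distr_eq_coin:
  assumes [measurable]: "X \<in> borel_measurable M"
    and X0: "prob {\<omega> \<in> space M. X \<omega> = 0} = 1/2" and X1: "prob {\<omega> \<in> space M. X \<omega> = 1} = 1/2"
  shows "distr M borel X = coin"
proof (rule measure_eqI)
  fix E assume "E \<in> sets (distr M borel X)"
  then have [measurable]: "E \<in> sets borel" by simp
  let ?S = "\<lambda>x. {\<omega> \<in> space M. X \<omega> = x}"
  have S: "prob (?S 0 \<union> ?S 1) = 1"
    using X0 X1 by (subst finite_measure_Union) auto
  have "AE \<omega> in M. \<omega> \<in> ?S 0 \<union> ?S 1"
    using S by (subst prob_eq_1[symmetric]) auto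
  moreover have SE: "?S x \<inter> X -` E \<in> events" for x
  proof -
    have "?S x \<inter> X -` E = {\<omega> \<in> space M. X \<omega> = x \<and> X \<omega> \<in> E}" by auto
    then show ?thesis by simp
  qed
  ultimately have "prob (X -` E \<inter> space M) = prob ((?S 0 \<inter> X -` E) \<union> (?S 1 \<inter> X -` E))"
    by (intro finite_measure_eq_AE) auto
  also have "\<dots> = prob (?S 0 \<inter> X -` E) + prob (?S 1 \<inter> X -` E)"
    using SE by (intro finite_measure_Union) auto
  also have "\<dots> = indicator E 0 * prob (?S 0) + indicator E 1 * prob (?S 1)"
  proof -
    have "prob (?S x \<inter> X -` E) = indicator E x * prob (?S x)" for x
    proof (cases "x \<in> E")
      case True
      then have "?S x \<inter> X -` E = ?S x" by auto
      then show ?thesis using True by simp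
    next
      case False
      then have "?S x \<inter> X -` E = {}" by auto
      then show ?thesis using False by simp
    qed
    then show ?thesis by simp
  qed
  also have "\<dots> = real (card ({0, 1} \<inter> E)) / 2"
    by (cases "0 \<in> E"; cases "1 \<in> E") (simp_all add: X0 X1)
  finally have "emeasure (distr M borel X) E = ennreal (real (card ({0, 1} \<inter> E)) / 2)"
    by (simp add: emeasure_distr emeasure_eq_measure)
  also have "\<dots> = emeasure coin E"
    by (simp add: coin_def emeasure_distr emeasure_pmf_of_set)
  finally show "emeasure (distr M borel X) E = emeasure coin E" .
qed simp

section \<open>Joint law of the parameter pairs\<close>

lemma prob_space_density:
  assumes "prob_density \<pi>"
  shows "prob_space (density lborel (\<lambda>\<xi>. ennreal (\<pi> \<xi>)))"
  using assms by (intro prob_spaceI) (auto simp: prob_density_def emeasure_density)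

definition param_law :: "(real^'d \<Rightarrow> real) \<Rightarrow> ((real^'d) \<times> real) measure" where
  "param_law \<pi> = density lborel (\<lambda>\<xi>. ennreal (\<pi> \<xi>)) \<Otimes>\<^sub>M coin"

lemma sets_param_law [measurable_cong]: "sets (param_law \<pi>) = sets (borel \<Otimes>\<^sub>M borel)"
  unfolding param_law_def by (rule sets_pair_measure_cong) simp_all

lemma prob_space_param_law:
  assumes "prob_density \<pi>"
  shows "prob_space (param_law \<pi>)"
proof -
  interpret D: prob_space "density lborel (\<lambda>\<xi>. ennreal (\<pi> \<xi>))" by (rule prob_space_density[OF assms])
  interpret C: prob_space coin by (rule prob_space_coin)
  interpret pair_prob_space "density lborel (\<lambda>\<xi>. ennreal (\<pi> \<xi>))" coin ..
  show ?thesis unfolding param_law_def by unfold_locales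
qed

lemma nn_integral_param_law:
  assumes \<pi>: "prob_density \<pi>" and [measurable]: "h \<in> borel_measurable (borel \<Otimes>\<^sub>M borel)"
  shows "(\<integral>\<^sup>+p. h p \<partial>param_law \<pi>) = (\<integral>\<^sup>+\<xi>. ennreal (\<pi> \<xi>) * ((h (\<xi>, 0) + h (\<xi>, 1)) / 2) \<partial>lborel)"
proof -
  interpret C: prob_space coin by (rule prob_space_coin)
  have [measurable]: "\<pi> \<in> borel_measurable borel" using \<pi> by (simp add: prob_density_def)
  have "(\<integral>\<^sup>+p. h p \<partial>param_law \<pi>) = (\<integral>\<^sup>+\<xi>. \<integral>\<^sup>+b. h (\<xi>, b) \<partial>coin \<partial>density lborel (\<lambda>\<xi>. ennreal (\<pi> \<xi>)))"
    unfolding param_law_def by (rule C.nn_integral_fst[symmetric]) measurable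
  also have "\<dots> = (\<integral>\<^sup>+\<xi>. (h (\<xi>, 0) + h (\<xi>, 1)) / 2 \<partial>density lborel (\<lambda>\<xi>. ennreal (\<pi> \<xi>)))"
    by (simp add: nn_integral_coin)
  also have "\<dots> = (\<integral>\<^sup>+\<xi>. ennreal (\<pi> \<xi>) * ((h (\<xi>, 0) + h (\<xi>, 1)) / 2) \<partial>lborel)"
    by (rule nn_integral_density) measurable
  finally show ?thesis .
qed

lemma integral_param_law:
  fixes h :: "(real^'d) \<times> real \<Rightarrow> real"
  assumes \<pi>: "prob_density \<pi>" and h: "integrable (param_law \<pi>) h"
  shows "(LINT p|param_law \<pi>. h p) = (LINT \<xi>|lborel. \<pi> \<xi> * ((h (\<xi>, 0) + h (\<xi>, 1)) / 2))"
proof -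
  interpret D: prob_space "density lborel (\<lambda>\<xi>. ennreal (\<pi> \<xi>))" by (rule prob_space_density[OF \<pi>])
  interpret C: prob_space coin by (rule prob_space_coin)
  interpret pair_prob_space "density lborel (\<lambda>\<xi>. ennreal (\<pi> \<xi>))" coin ..
  have [measurable]: "\<pi> \<in> borel_measurable borel" and pos: "\<And>\<xi>. 0 \<le> \<pi> \<xi>"
    using \<pi> by (auto simp: prob_density_def)
  have [measurable]: "h \<in> borel_measurable (borel \<Otimes>\<^sub>M borel)"
    using borel_measurable_integrable[OF h] by (simp cong: measurable_cong_sets add: sets_param_law)
  have "(LINT p|param_law \<pi>. h p) = (LINT \<xi>|density lborel (\<lambda>\<xi>. ennreal (\<pi> \<xi>)). LINT b|coin. h (\<xi>, b))"
    using integral_fst'[OF h[unfolded param_law_def]] by (simp add: param_law_def)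
  also have "\<dots> = (LINT \<xi>|density lborel (\<lambda>\<xi>. ennreal (\<pi> \<xi>)). (h (\<xi>, 0) + h (\<xi>, 1)) / 2)"
    by (simp add: integral_coin)
  also have "\<dots> = (LINT \<xi>|lborel. \<pi> \<xi> *\<^sub>R ((h (\<xi>, 0) + h (\<xi>, 1)) / 2))"
    using pos by (intro integral_density) auto
  finally show ?thesis by simp
qed

text \<open>Independence is given within \<open>A\<close>, within \<open>B\<close> and between the
  two families; combined, the three make probabilities of rectangles factor. Rectangles form an
  intersection-stable generator, so the pairs are independent with a product law each.\<close>

lemma random_params_distr:
  fixes A :: "nat \<Rightarrow> 'w \<Rightarrow> real^'d"
  assumes P: "prob_space P" and \<pi>: "prob_density \<pi>" and rp: "random_params P n \<pi> A B" and n: "n \<ge> 1"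
  shows "\<And>i. i \<in> {1..n} \<Longrightarrow> A i \<in> borel_measurable P" (is "\<And>i. _ \<Longrightarrow> ?A i")
    and "\<And>i. i \<in> {1..n} \<Longrightarrow> B i \<in> borel_measurable P" (is "\<And>i. _ \<Longrightarrow> ?B i")
    and "distr P (PiM {1..n} (\<lambda>_. borel \<Otimes>\<^sub>M borel)) (\<lambda>\<omega>. \<lambda>i\<in>{1..n}. (A i \<omega>, B i \<omega>))
      = PiM {1..n} (\<lambda>_. param_law \<pi>)"
proof -
  interpret prob_space P by fact
  let ?I = "{1..n}"
  from rp have dA: "\<And>i. i \<in> ?I \<Longrightarrow> distributed P lborel (A i) (\<lambda>\<xi>. ennreal (\<pi> \<xi>))"
    and iA: "indep_vars (\<lambda>_. borel) A ?I" and iB: "indep_vars (\<lambda>_. borel) B ?I"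
    and dB: "\<And>i. i \<in> ?I \<Longrightarrow> prob {\<omega> \<in> space P. B i \<omega> = 0} = 1/2"
      "\<And>i. i \<in> ?I \<Longrightarrow> prob {\<omega> \<in> space P. B i \<omega> = 1} = 1/2"
    and iAB: "indep_set (sets (vimage_algebra (space P) (family_of n A) (PiM ?I (\<lambda>_. borel))))
       (sets (vimage_algebra (space P) (family_of n B) (PiM ?I (\<lambda>_. borel))))"
    unfolding random_params_def by auto
  show mA: "?A i" if "i \<in> ?I" for i
    using dA[OF that] by (simp add: distributed_def)
  show mB: "?B i" if "i \<in> ?I" for i
    using iB that by (simp add: indep_vars_def)
  have mAB: "(\<lambda>\<omega>. (A i \<omega>, B i \<omega>)) \<in> P \<rightarrow>\<^sub>M borel \<Otimes>\<^sub>M borel" if "i \<in> ?I" for i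
    using mA[OF that] mB[OF that] by (rule measurable_Pair)
  have rect: "prob (\<Inter>j\<in>J. (\<lambda>\<omega>. (A j \<omega>, B j \<omega>)) -` (E j \<times> F j) \<inter> space P)
      = (\<Prod>j\<in>J. prob (A j -` E j \<inter> space P) * prob (B j -` F j \<inter> space P))"
    if J: "J \<subseteq> ?I" "J \<noteq> {}" and E: "\<And>j. j \<in> J \<Longrightarrow> E j \<in> sets borel"
      and F: "\<And>j. j \<in> J \<Longrightarrow> F j \<in> sets borel" for J and E :: "nat \<Rightarrow> (real^'d) set" and F :: "nat \<Rightarrow> real set"
  proof -
    have fin: "finite J" using J(1) finite_subset by blast
    \<comment> \<open>Independence between \<open>A\<close> and \<open>B\<close> is assumed for the
      sigma-algebras of whole families, so an event about a few coordinates has to be exhibited as a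
      preimage under \<open>family_of\<close>.\<close>
    have pre: "(\<Inter>j\<in>J. X j -` G j \<inter> space P)
        \<in> sets (vimage_algebra (space P) (family_of n X) (PiM ?I (\<lambda>_. borel)))"
      if G: "\<And>j. j \<in> J \<Longrightarrow> G j \<in> sets borel" for X :: "nat \<Rightarrow> 'w \<Rightarrow> 'c::topological_space" and G
    proof -
      have "{f \<in> space (PiM ?I (\<lambda>_. borel)). \<forall>j\<in>J. f j \<in> G j} \<in> sets (PiM ?I (\<lambda>_. borel :: 'c measure))"
        using fin J G by (intro sets.sets_Collect_finite_All) (auto intro!: measurable_sets_Collect
            [OF measurable_component_singleton[where M = "\<lambda>_. borel"], of _ ?I "\<lambda>x. x \<in> G _"])
      from in_vimage_algebra[OF this, of "family_of n X" "space P"]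
      have "family_of n X -` {f \<in> space (PiM ?I (\<lambda>_. borel)). \<forall>j\<in>J. f j \<in> G j} \<inter> space P
          \<in> sets (vimage_algebra (space P) (family_of n X) (PiM ?I (\<lambda>_. borel)))" .
      also have "family_of n X -` {f \<in> space (PiM ?I (\<lambda>_. borel)). \<forall>j\<in>J. f j \<in> G j} \<inter> space P
          = (\<Inter>j\<in>J. X j -` G j \<inter> space P)"
        using J by (auto simp: family_of_def space_PiM)
      finally show ?thesis .
    qed
    have "(\<Inter>j\<in>J. (\<lambda>\<omega>. (A j \<omega>, B j \<omega>)) -` (E j \<times> F j) \<inter> space P)
        = (\<Inter>j\<in>J. A j -` E j \<inter> space P) \<inter> (\<Inter>j\<in>J. B j -` F j \<inter> space P)"
      by auto
    also have "prob \<dots> = prob (\<Inter>j\<in>J. A j -` E j \<inter> space P) * prob (\<Inter>j\<in>J. B j -` F j \<inter> space P)"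
      using E F by (intro indep_setD[OF iAB] pre)
    also have "prob (\<Inter>j\<in>J. A j -` E j \<inter> space P) = (\<Prod>j\<in>J. prob (A j -` E j \<inter> space P))"
      using J fin E by (intro indep_varsD[OF iA]) auto
    also have "prob (\<Inter>j\<in>J. B j -` F j \<inter> space P) = (\<Prod>j\<in>J. prob (B j -` F j \<inter> space P))"
      using J fin F by (intro indep_varsD[OF iB]) auto
    finally show ?thesis by (simp add: prod.distrib)
  qed
  have rect1: "prob ((\<lambda>\<omega>. (A i \<omega>, B i \<omega>)) -` (E \<times> F) \<inter> space P)
      = prob (A i -` E \<inter> space P) * prob (B i -` F \<inter> space P)"
    if "i \<in> ?I" "E \<in> sets borel" "F \<in> sets borel" for i E F
    using rect[of "{i}" "\<lambda>_. E" "\<lambda>_. F"] that by simp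
  have law: "distr P (borel \<Otimes>\<^sub>M borel) (\<lambda>\<omega>. (A i \<omega>, B i \<omega>)) = param_law \<pi>" if i: "i \<in> ?I" for i
  proof -
    interpret D: prob_space "density lborel (\<lambda>\<xi>. ennreal (\<pi> \<xi>))" by (rule prob_space_density[OF \<pi>])
    interpret C: prob_space coin by (rule prob_space_coin)
    have lA: "density lborel (\<lambda>\<xi>. ennreal (\<pi> \<xi>)) = distr P borel (A i)"
      using dA[OF i] unfolding distributed_def by (metis distr_cong sets_lborel)
    have lB: "coin = distr P borel (B i)"
      using distr_eq_coin[OF mB[OF i] dB(1)[OF i] dB(2)[OF i]] by simp
    have "param_law \<pi> = distr P (borel \<Otimes>\<^sub>M borel) (\<lambda>\<omega>. (A i \<omega>, B i \<omega>))"
      unfolding param_law_def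
    proof (rule pair_measure_eqI)
      show "sigma_finite_measure (density lborel (\<lambda>\<xi>. ennreal (\<pi> \<xi>)))" "sigma_finite_measure coin" ..
      show "sets (density lborel (\<lambda>\<xi>. ennreal (\<pi> \<xi>)) \<Otimes>\<^sub>M coin)
          = sets (distr P (borel \<Otimes>\<^sub>M borel) (\<lambda>\<omega>. (A i \<omega>, B i \<omega>)))"
        using sets_param_law[of \<pi>] by (simp add: param_law_def)
      fix E F assume "E \<in> sets (density lborel (\<lambda>\<xi>. ennreal (\<pi> \<xi>)))" "F \<in> sets coin"
      then have EF: "E \<in> sets borel" "F \<in> sets borel" by simp_all
      then have "E \<times> F \<in> sets (borel \<Otimes>\<^sub>M borel)" by (rule pair_measureI)
      then show "emeasure (density lborel (\<lambda>\<xi>. ennreal (\<pi> \<xi>))) E * emeasure coin F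
          = emeasure (distr P (borel \<Otimes>\<^sub>M borel) (\<lambda>\<omega>. (A i \<omega>, B i \<omega>))) (E \<times> F)"
        unfolding lA lB using EF rect1[OF i EF] mA[OF i] mB[OF i] mAB[OF i]
        by (simp add: emeasure_distr emeasure_eq_measure flip: ennreal_mult)
    qed
    then show ?thesis by simp
  qed
  have I: "?I \<noteq> {}" using n by simp
  let ?E = "{a \<times> b | a b. a \<in> sets (borel :: (real^'d) measure) \<and> b \<in> sets (borel :: real measure)}"
  have "indep_vars (\<lambda>_. borel \<Otimes>\<^sub>M borel) (\<lambda>i \<omega>. (A i \<omega>, B i \<omega>)) ?I"
  proof (subst indep_vars_finite[where E = "\<lambda>_. ?E"])
    show "Int_stable ?E" by (rule Int_stable_pair_measure_generator)
    show "sets (borel \<Otimes>\<^sub>M borel) = sigma_sets (space (borel \<Otimes>\<^sub>M borel)) ?E"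
      by (simp add: sets_pair_measure space_pair_measure)
    show "space (borel \<Otimes>\<^sub>M borel) \<in> ?E"
      using sets.top[of "borel :: (real^'d) measure"] sets.top[of "borel :: real measure"]
      unfolding space_pair_measure by blast
    show "?E \<subseteq> Pow (space (borel \<Otimes>\<^sub>M borel))"
      by (auto simp: space_pair_measure)
    show "\<forall>X\<in>?I \<rightarrow> ?E. prob (\<Inter>j\<in>?I. (\<lambda>\<omega>. (A j \<omega>, B j \<omega>)) -` X j \<inter> space P)
        = (\<Prod>j\<in>?I. prob ((\<lambda>\<omega>. (A j \<omega>, B j \<omega>)) -` X j \<inter> space P))"
    proof
      fix X assume X: "X \<in> ?I \<rightarrow> ?E"
      have "\<forall>j\<in>?I. \<exists>a b. X j = a \<times> b \<and> a \<in> sets borel \<and> b \<in> sets borel"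
        using funcset_mem[OF X] by blast
      then obtain E F where X: "\<And>j. j \<in> ?I \<Longrightarrow> X j = E j \<times> F j"
        and EF: "\<And>j. j \<in> ?I \<Longrightarrow> E j \<in> sets borel" "\<And>j. j \<in> ?I \<Longrightarrow> F j \<in> sets borel"
        by metis
      have "prob (\<Inter>j\<in>?I. (\<lambda>\<omega>. (A j \<omega>, B j \<omega>)) -` X j \<inter> space P)
          = prob (\<Inter>j\<in>?I. (\<lambda>\<omega>. (A j \<omega>, B j \<omega>)) -` (E j \<times> F j) \<inter> space P)"
        using X by (intro arg_cong[where f = prob] INF_cong) auto
      also have "\<dots> = (\<Prod>j\<in>?I. prob (A j -` E j \<inter> space P) * prob (B j -` F j \<inter> space P))"
        using I EF by (intro rect) auto
      also have "\<dots> = (\<Prod>j\<in>?I. prob ((\<lambda>\<omega>. (A j \<omega>, B j \<omega>)) -` X j \<inter> space P))"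
        using EF X rect1 by (intro prod.cong) auto
      finally show "prob (\<Inter>j\<in>?I. (\<lambda>\<omega>. (A j \<omega>, B j \<omega>)) -` X j \<inter> space P)
        = (\<Prod>j\<in>?I. prob ((\<lambda>\<omega>. (A j \<omega>, B j \<omega>)) -` X j \<inter> space P))" .
    qed
  qed (use I mAB in auto)
  then have "distr P (PiM ?I (\<lambda>_. borel \<Otimes>\<^sub>M borel)) (\<lambda>\<omega>. \<lambda>i\<in>?I. (A i \<omega>, B i \<omega>))
      = PiM ?I (\<lambda>i. distr P (borel \<Otimes>\<^sub>M borel) (\<lambda>\<omega>. (A i \<omega>, B i \<omega>)))"
    by (rule indep_vars_iff_distr_eq_PiM'[THEN iffD1, rotated 2]) (use I mAB in auto)
  also have "\<dots> = PiM ?I (\<lambda>_. param_law \<pi>)"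
    using law by (intro PiM_cong) auto
  finally show "distr P (PiM ?I (\<lambda>_. borel \<Otimes>\<^sub>M borel)) (\<lambda>\<omega>. \<lambda>i\<in>?I. (A i \<omega>, B i \<omega>))
      = PiM ?I (\<lambda>_. param_law \<pi>)" .
qed

section \<open>The random network as an estimator\<close>

text \<open>The factor 2 undoes the probability 1/2 of either coin value. Every value other than 0
  is read as 1; other values occur only on a null set.\<close>

definition weight :: "(real^'d \<Rightarrow> real) \<Rightarrow> (real^'d \<Rightarrow> real) \<Rightarrow> (real^'d) \<times> real \<Rightarrow> real" where
  "weight \<pi> f p = 2 * (if snd p = 0 then Re (fourier f (fst p) / of_real (\<pi> (fst p)))
    else Im (fourier f (fst p) / of_real (\<pi> (fst p))))"

definition neuron :: "(real^'d \<Rightarrow> real) \<Rightarrow> (real^'d \<Rightarrow> real) \<Rightarrow> real^'d \<Rightarrow> (real^'d) \<times> real \<Rightarrow> real" where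
  "neuron \<pi> f x p = weight \<pi> f p * cos (2 * pi * inner (fst p) x + pi / 2 * snd p)"

lemma fourier_measurable:
  assumes "f \<in> class_F \<pi>"
  shows "fourier f \<in> borel_measurable borel"
proof -
  have "integrable lborel (fourier f)" using assms by (simp add: class_F_def)
  from borel_measurable_integrable[OF this] show ?thesis by simp
qed

lemma class_F_inversion:
  assumes "f \<in> class_F \<pi>"
  shows "(LINT \<xi>|lborel. Re (exp (2 * of_real pi * \<i> * of_real (inner x \<xi>)) * fourier f \<xi>)) = f x"
proof -
  from assms have c: "continuous_on UNIV f" and i: "integrable lborel f" and F: "integrable lborel (fourier f)"
    by (auto simp: class_F_def)
  have [measurable]: "fourier f \<in> borel_measurable borel"
    using borel_measurable_integrable[OF F] by simp
  have n1: "norm (exp (2 * of_real pi * \<i> * of_real r)) = 1" for r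
    using norm_exp_i_times[of "2 * pi * r"] by (simp add: mult_ac)
  have int: "integrable lborel (\<lambda>\<xi>. exp (2 * of_real pi * \<i> * of_real (inner x \<xi>)) * fourier f \<xi>)"
  proof (rule Bochner_Integration.integrable_bound[OF F])
    show "(\<lambda>\<xi>. exp (2 * of_real pi * \<i> * of_real (inner x \<xi>)) * fourier f \<xi>) \<in> borel_measurable lborel"
      by measurable
  qed (simp add: norm_mult n1)
  have "isCont (\<lambda>y. complex_of_real (f y)) x"
    using c by (intro continuous_of_real) (simp add: continuous_on_eq_continuous_at)
  then have "(LINT \<xi>|lborel. exp (2 * of_real pi * \<i> * of_real (inner x \<xi>)) * fourier f \<xi>) = of_real (f x)"
    using fourier_inversion[of "\<lambda>y. complex_of_real (f y)" x] i F
    unfolding fourier_def[abs_def] by simp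
  then show "(LINT \<xi>|lborel. Re (exp (2 * of_real pi * \<i> * of_real (inner x \<xi>)) * fourier f \<xi>)) = f x"
    by (simp only: integral_Re[OF int] Re_complex_of_real)
qed

text \<open>The random frequencies never see the zero set of the density, so the transform must
  vanish there for the estimator to be unbiased. This is absolute continuity applied to that zero
  set.\<close>

lemma class_F_AE:
  assumes \<pi>: "prob_density \<pi>" and f: "f \<in> class_F \<pi>"
  shows "AE \<xi> in lborel. \<pi> \<xi> = 0 \<longrightarrow> fourier f \<xi> = 0"
proof -
  have [measurable]: "\<pi> \<in> borel_measurable borel" using \<pi> by (simp add: prob_density_def)
  note [measurable] = fourier_measurable[OF f]
  let ?S = "{\<xi>. \<pi> \<xi> = 0}"
  have [measurable]: "?S \<in> sets borel" by measurable
  have "?S \<in> null_sets (density lborel (\<lambda>\<xi>. ennreal (\<pi> \<xi>)))"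
    by (subst null_sets_density_iff) auto
  then have "?S \<in> null_sets (density lborel (\<lambda>\<xi>. ennreal (cmod (fourier f \<xi>))))"
    using f by (auto simp: class_F_def absolutely_continuous_def)
  then have "AE \<xi> in lborel. \<xi> \<in> ?S \<longrightarrow> ennreal (cmod (fourier f \<xi>)) = 0"
    by (subst (asm) null_sets_density_iff) auto
  then show ?thesis by eventually_elim auto
qed

lemma weight_measurable:
  assumes "prob_density \<pi>" "f \<in> class_F \<pi>"
  shows "weight \<pi> f \<in> borel_measurable (borel \<Otimes>\<^sub>M borel)"
proof -
  have [measurable]: "\<pi> \<in> borel_measurable borel" using assms by (simp add: prob_density_def)
  note [measurable] = fourier_measurable[OF assms(2)]
  show ?thesis unfolding weight_def[abs_def] by measurable
qed

lemma neuron_measurable: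
  assumes "prob_density \<pi>" "f \<in> class_F \<pi>"
  shows "neuron \<pi> f x \<in> borel_measurable (borel \<Otimes>\<^sub>M borel)"
  using weight_measurable[OF assms] unfolding neuron_def[abs_def] by measurable

section \<open>Bounds and moments of one neuron\<close>

lemma cmod_ratio_le:
  assumes "f \<in> class_Fb \<pi>"
  shows "cmod (fourier f \<xi> / of_real (\<pi> \<xi>)) \<le> ratio_sup_norm \<pi> f"
  unfolding ratio_sup_norm_def
proof (rule cSUP_upper)
  have "bounded (range (\<lambda>\<xi>. fourier f \<xi> / of_real (\<pi> \<xi>)))"
    using assms by (simp add: class_Fb_def)
  then show "bdd_above (range (\<lambda>\<xi>. cmod (fourier f \<xi> / of_real (\<pi> \<xi>))))"
    unfolding bounded_iff bdd_above_def by blast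
qed simp

lemma abs_weight_le:
  assumes "f \<in> class_Fb \<pi>"
  shows "\<bar>weight \<pi> f p\<bar> \<le> 2 * ratio_sup_norm \<pi> f"
  using cmod_ratio_le[OF assms, of "fst p"]
    abs_Re_le_cmod[of "fourier f (fst p) / of_real (\<pi> (fst p))"]
    abs_Im_le_cmod[of "fourier f (fst p) / of_real (\<pi> (fst p))"]
  unfolding weight_def abs_mult by (simp del: Re_divide_of_real Im_divide_of_real)

lemma abs_neuron_le:
  assumes "f \<in> class_Fb \<pi>"
  shows "\<bar>neuron \<pi> f x p\<bar> \<le> 2 * ratio_sup_norm \<pi> f"
proof -
  have "\<bar>neuron \<pi> f x p\<bar> \<le> \<bar>weight \<pi> f p\<bar> * 1"
    unfolding neuron_def abs_mult by (intro mult_left_mono) auto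
  then show ?thesis using abs_weight_le[OF assms, of p] by simp
qed

lemma
  assumes \<pi>: "prob_density \<pi>" and f: "f \<in> class_Fb \<pi>"
  shows integrable_neuron: "integrable (param_law \<pi>) (neuron \<pi> f x)"
    and integrable_neuron_square: "integrable (param_law \<pi>) (\<lambda>p. (neuron \<pi> f x p)\<^sup>2)"
proof -
  interpret prob_space "param_law \<pi>" by (rule prob_space_param_law[OF \<pi>])
  have fF: "f \<in> class_F \<pi>" using f by (simp add: class_Fb_def)
  have [measurable]: "neuron \<pi> f x \<in> borel_measurable (param_law \<pi>)"
    using neuron_measurable[OF \<pi> fF] by (simp cong: measurable_cong_sets add: sets_param_law)
  show "integrable (param_law \<pi>) (neuron \<pi> f x)"
    using abs_neuron_le[OF f] by (intro integrable_const_bound[where B = "2 * ratio_sup_norm \<pi> f"]) auto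
  have "(neuron \<pi> f x p)\<^sup>2 \<le> (2 * ratio_sup_norm \<pi> f)\<^sup>2" for p
    using abs_neuron_le[OF f, of x p] by (intro abs_le_square_iff[THEN iffD1]) linarith
  then show "integrable (param_law \<pi>) (\<lambda>p. (neuron \<pi> f x p)\<^sup>2)"
    by (intro integrable_const_bound[where B = "(2 * ratio_sup_norm \<pi> f)\<^sup>2"]) auto
qed

text \<open>Since \<open>cos (t + pi / 2) = - sin t\<close>, averaging over the coin assembles the real part of
  the integrand of the inverse Fourier transform.\<close>

lemma expectation_neuron:
  assumes \<pi>: "prob_density \<pi>" and f: "f \<in> class_Fb \<pi>"
  shows "(LINT p|param_law \<pi>. neuron \<pi> f x p) = f x"
proof -
  have fF: "f \<in> class_F \<pi>" using f by (simp add: class_Fb_def)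
  have [measurable]: "\<pi> \<in> borel_measurable borel" using \<pi> by (simp add: prob_density_def)
  note [measurable] = fourier_measurable[OF fF]
  note [measurable] = neuron_measurable[OF \<pi> fF]
  have "(LINT p|param_law \<pi>. neuron \<pi> f x p)
      = (LINT \<xi>|lborel. \<pi> \<xi> * ((neuron \<pi> f x (\<xi>, 0) + neuron \<pi> f x (\<xi>, 1)) / 2))"
    by (rule integral_param_law[OF \<pi> integrable_neuron[OF \<pi> f]])
  also have "\<dots> = (LINT \<xi>|lborel. Re (exp (2 * of_real pi * \<i> * of_real (inner x \<xi>)) * fourier f \<xi>))"
  proof (rule integral_cong_AE)
    show "AE \<xi> in lborel. \<pi> \<xi> * ((neuron \<pi> f x (\<xi>, 0) + neuron \<pi> f x (\<xi>, 1)) / 2)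
        = Re (exp (2 * of_real pi * \<i> * of_real (inner x \<xi>)) * fourier f \<xi>)"
      using class_F_AE[OF \<pi> fF]
    proof eventually_elim
      case (elim \<xi>)
      have e: "exp (2 * of_real pi * \<i> * of_real (inner x \<xi>))
          = cis (2 * pi * inner \<xi> x)"
        by (simp add: cis_conv_exp inner_commute mult_ac)
      show ?case
      proof (cases "\<pi> \<xi> = 0")
        case False
        define t where "t = 2 * pi * inner \<xi> x"
        have "cos (t + pi / 2) = - sin t" by (simp add: cos_add)
        then have "neuron \<pi> f x (\<xi>, 1) = - 2 * (Im (fourier f \<xi>) / \<pi> \<xi>) * sin t"
          "neuron \<pi> f x (\<xi>, 0) = 2 * (Re (fourier f \<xi>) / \<pi> \<xi>) * cos t"
          by (simp_all add: neuron_def weight_def t_def)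
        then have "\<pi> \<xi> * ((neuron \<pi> f x (\<xi>, 0) + neuron \<pi> f x (\<xi>, 1)) / 2)
            = cos t * Re (fourier f \<xi>) - sin t * Im (fourier f \<xi>)"
          using False by (simp add: field_simps)
        then show ?thesis
          unfolding e t_def[symmetric] by simp
      qed (use elim in simp)
    qed
  qed measurable
  also have "\<dots> = f x" by (rule class_F_inversion[OF fF])
  finally show ?thesis .
qed

text \<open>At x = 0 the cosine is 1 for coin value 0 and 0 for coin value 1, so only the real part
  is left. The 2 inside \<open>L2bar\<close> is the squared factor 4 of the weight times the
  probability 1/2.\<close>

lemma expectation_neuron_square_le:
  assumes \<pi>: "prob_density \<pi>" and f: "f \<in> class_Fb \<pi>"
  shows "(LINT p|param_law \<pi>. (neuron \<pi> f 0 p)\<^sup>2) \<le> (L2bar \<pi> f)\<^sup>2"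
proof -
  have fF: "f \<in> class_F \<pi>" using f by (simp add: class_Fb_def)
  have pos: "0 \<le> \<pi> \<xi>" for \<xi> using \<pi> by (simp add: prob_density_def)
  have int: "integrable lborel (\<lambda>\<xi>. (cmod (fourier f \<xi>))\<^sup>2 / \<pi> \<xi>)"
    using fF by (simp add: class_F_def)
  have le: "\<pi> \<xi> * (((neuron \<pi> f 0 (\<xi>, 0))\<^sup>2 + (neuron \<pi> f 0 (\<xi>, 1))\<^sup>2) / 2)
      \<le> 2 * ((cmod (fourier f \<xi>))\<^sup>2 / \<pi> \<xi>)" for \<xi>
  proof (cases "\<pi> \<xi> = 0")
    case False
    have "\<pi> \<xi> * (((neuron \<pi> f 0 (\<xi>, 0))\<^sup>2 + (neuron \<pi> f 0 (\<xi>, 1))\<^sup>2) / 2)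
        = 2 * ((Re (fourier f \<xi>))\<^sup>2 / \<pi> \<xi>)"
      using False by (simp add: neuron_def weight_def power2_eq_square)
    also have "\<dots> \<le> 2 * ((cmod (fourier f \<xi>))\<^sup>2 / \<pi> \<xi>)"
      using pos[of \<xi>] abs_Re_le_cmod[of "fourier f \<xi>"]
      by (intro mult_left_mono divide_right_mono) (auto simp: abs_le_square_iff[symmetric])
    finally show ?thesis .
  qed simp
  have "(LINT p|param_law \<pi>. (neuron \<pi> f 0 p)\<^sup>2)
      = (LINT \<xi>|lborel. \<pi> \<xi> * (((neuron \<pi> f 0 (\<xi>, 0))\<^sup>2 + (neuron \<pi> f 0 (\<xi>, 1))\<^sup>2) / 2))"
    by (rule integral_param_law[OF \<pi> integrable_neuron_square[OF \<pi> f]])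
  also have "\<dots> \<le> (LINT \<xi>|lborel. 2 * ((cmod (fourier f \<xi>))\<^sup>2 / \<pi> \<xi>))"
    using pos le
    by (intro integral_mono'[OF integrable_mult_right[OF int]])
      (auto intro!: mult_nonneg_nonneg divide_nonneg_nonneg)
  also have "\<dots> = (L2bar \<pi> f)\<^sup>2"
    using pos unfolding L2bar_def integral_mult_right_zero by simp
  finally show ?thesis .
qed

section \<open>From the cube to a sequence\<close>

lemma cube_dense_sequence:
  assumes "M > 0"
  obtains q :: "nat \<Rightarrow> real^'d" where "q 0 = 0" "range q \<subseteq> {x. \<forall>j. vec_nth x j \<in> {-M..M}}"
    "{x. \<forall>j. vec_nth x j \<in> {-M..M}} \<subseteq> closure (range q)"
proof -
  let ?S = "{x :: real^'d. \<forall>j. vec_nth x j \<in> {-M..M}}"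
  obtain T where T: "countable T" "T \<subseteq> ?S" "?S \<subseteq> closure T"
    by (rule separable[of ?S])
  define D where "D = insert 0 T"
  \<comment> \<open>Index 0 is reserved for the origin; the enumeration of \<open>D\<close> is
    shifted by one.\<close>
  define q where "q i = (if i = 0 then 0 else from_nat_into D (i - 1))" for i
  have D: "countable D" "D \<noteq> {}" using T(1) by (simp_all add: D_def)
  have "D \<subseteq> range q"
  proof
    fix x assume "x \<in> D"
    then obtain i where "x = from_nat_into D i"
      using from_nat_into_surj[OF D(1)] by blast
    then have "x = q (Suc i)" by (simp add: q_def)
    then show "x \<in> range q" by blast
  qed
  moreover have "range q \<subseteq> D"
    using D from_nat_into[OF D(2)] by (auto simp: q_def D_def)
  ultimately have "range q = D" by blast
  show thesis
  proof
    show "q 0 = 0" by (simp add: q_def)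
    show "range q \<subseteq> ?S" using T assms \<open>range q = D\<close> by (auto simp: D_def)
    show "?S \<subseteq> closure (range q)"
      using T(3) closure_mono[of T "range q"] \<open>range q = D\<close> by (auto simp: D_def)
  qed
qed

lemma norm_le_cube:
  fixes x :: "real^'d"
  assumes "\<forall>j. vec_nth x j \<in> {-M..M}"
  shows "norm x \<le> M * sqrt (real CARD('d))"
proof -
  have M: "0 \<le> M" using assms[rule_format, of undefined] by simp
  have "(norm x)\<^sup>2 = (\<Sum>j\<in>UNIV. (vec_nth x j)\<^sup>2)"
    unfolding power2_norm_eq_inner inner_vec_def by (simp add: power2_eq_square)
  also have "\<dots> \<le> (\<Sum>j\<in>(UNIV::'d set). M\<^sup>2)"
  proof (rule sum_mono)
    fix j
    show "(vec_nth x j)\<^sup>2 \<le> M\<^sup>2"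
      using assms[rule_format, of j] by (intro abs_le_square_iff[THEN iffD1]) auto
  qed
  also have "\<dots> = (M * sqrt (real CARD('d)))\<^sup>2"
    by (simp add: power_mult_distrib)
  finally show ?thesis
    by (rule power2_le_imp_le) (use M in simp)
qed

text \<open>The points where |h| stays below the supremum along the sequence form a closed set,
  which therefore contains the closure of the sequence. This makes the uniform error a countable
  supremum.\<close>

lemma SUP_ennreal_dense:
  fixes h :: "'a::metric_space \<Rightarrow> real"
  assumes h: "continuous_on UNIV h" and q: "range q \<subseteq> S" "S \<subseteq> closure (range q)"
  shows "(SUP x\<in>S. ennreal \<bar>h x\<bar>) = (SUP i. ennreal \<bar>h (q i)\<bar>)"
proof (rule antisym)
  let ?c = "SUP i. ennreal \<bar>h (q i)\<bar>"
  have "closed {x. ennreal \<bar>h x\<bar> \<le> ?c}"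
    using h by (intro closed_Collect_le continuous_on_ennreal continuous_intros)
  moreover have "range q \<subseteq> {x. ennreal \<bar>h x\<bar> \<le> ?c}"
    by (auto intro: SUP_upper)
  ultimately have "closure (range q) \<subseteq> {x. ennreal \<bar>h x\<bar> \<le> ?c}"
    by (intro closure_minimal)
  then show "(SUP x\<in>S. ennreal \<bar>h x\<bar>) \<le> ?c"
    using q(2) by (intro SUP_least) auto
  show "?c \<le> (SUP x\<in>S. ennreal \<bar>h x\<bar>)"
    using q(1) by (intro SUP_least SUP_upper) auto
qed

lemma ratio_sup_norm_nonneg:
  assumes "f \<in> class_Fb \<pi>"
  shows "0 \<le> ratio_sup_norm \<pi> f"
  using cmod_ratio_le[OF assms] norm_ge_zero order_trans by blast

lemma abs_cos_diff_le: "\<bar>cos x - cos y\<bar> \<le> \<bar>x - y\<bar>" for x y :: real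
proof -
  have "\<bar>cos x - cos y\<bar> = 2 * (\<bar>sin ((x + y) / 2)\<bar> * \<bar>sin ((y - x) / 2)\<bar>)"
    by (simp add: cos_diff_cos abs_mult)
  also have "\<dots> \<le> 2 * (1 * \<bar>(y - x) / 2\<bar>)"
    by (intro mult_left_mono mult_mono abs_sin_x_le_abs_x) auto
  finally show ?thesis by simp
qed

section \<open>Expected uniform deviation\<close>

lemma nn_integral_sup_neuron_deviation_le:
  fixes \<pi> f :: "real^'d \<Rightarrow> real" and q :: "nat \<Rightarrow> real^'d"
  assumes \<pi>: "prob_density \<pi>" and \<pi>2: "integrable lborel (\<lambda>\<xi>. (norm \<xi>)\<^sup>2 * \<pi> \<xi>)"
    and f: "f \<in> class_Fb \<pi>" and q: "q 0 = 0" "\<And>i. norm (q i) \<le> r" and I: "finite I"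
  shows "(\<integral>\<^sup>+p. (SUP i. ennreal \<bar>\<Sum>k\<in>I. neuron \<pi> f (q i) (p k) - f (q i)\<bar>) \<partial>PiM I (\<lambda>_. param_law \<pi>))
    \<le> ennreal (16 * pi * ratio_sup_norm \<pi> f * r * sqrt (LINT \<xi>|lborel. (norm \<xi>)\<^sup>2 * \<pi> \<xi>) * sqrt (card I)
        + L2bar \<pi> f * sqrt (card I))"
proof -
  define K where "K = ratio_sup_norm \<pi> f"
  define \<sigma>2 where "\<sigma>2 = (LINT \<xi>|lborel. (norm \<xi>)\<^sup>2 * \<pi> \<xi>)"
  define Z where "Z p i = neuron \<pi> f (q i) p - neuron \<pi> f 0 p" for p i
  \<comment> \<open>The weight is at most 2 K and the cosine has Lipschitz constant 1, while the
    phase moves by 2 pi times the inner product with the frequency; together this gives 4 pi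
    K.\<close>
  define a where "a p = (4 * pi * K) *\<^sub>R fst p" for p :: "(real^'d) \<times> real"
  define s where "s = (4 * pi * K)\<^sup>2 * \<sigma>2"
  have fF: "f \<in> class_F \<pi>" using f by (simp add: class_Fb_def)
  have [measurable]: "\<pi> \<in> borel_measurable borel" and pos: "\<And>\<xi>. 0 \<le> \<pi> \<xi>"
    using \<pi> by (auto simp: prob_density_def)
  have K: "0 \<le> K" using ratio_sup_norm_nonneg[OF f] by (simp add: K_def)
  have \<sigma>2: "0 \<le> \<sigma>2" unfolding \<sigma>2_def using pos by (intro integral_nonneg_AE) auto
  have s: "0 \<le> s" using \<sigma>2 by (simp add: s_def)
  have r: "0 \<le> r" using q(2)[of 0] norm_ge_zero order_trans by blast
  have L2: "0 \<le> L2bar \<pi> f"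
    unfolding L2bar_def using pos by (auto intro!: integral_nonneg_AE)
  interpret prob_space "param_law \<pi>" by (rule prob_space_param_law[OF \<pi>])
  have a_meas [measurable]: "a \<in> borel_measurable (param_law \<pi>)"
    unfolding a_def by measurable
  interpret dominated_process "param_law \<pi>" Z "\<lambda>p i. inner (a p) (q i)"
  proof
    show "integrable (param_law \<pi>) (\<lambda>p. Z p i)" for i
      unfolding Z_def by (intro Bochner_Integration.integrable_diff integrable_neuron[OF \<pi> f])
    show "\<bar>Z p i - Z p j\<bar> \<le> \<bar>inner (a p) (q i) - inner (a p) (q j)\<bar>" for p i j
    proof -
      let ?t = "\<lambda>i. 2 * pi * inner (fst p) (q i) + pi / 2 * snd p"
      have "\<bar>Z p i - Z p j\<bar> = \<bar>weight \<pi> f p\<bar> * \<bar>cos (?t i) - cos (?t j)\<bar>"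
        by (simp add: Z_def neuron_def flip: abs_mult right_diff_distrib)
      also have "\<dots> \<le> (2 * K) * \<bar>?t i - ?t j\<bar>"
        using K abs_weight_le[OF f, of p] unfolding K_def
        by (intro mult_mono abs_cos_diff_le) auto
      also have "\<dots> = \<bar>(2 * K) * (?t i - ?t j)\<bar>"
        using K by (simp add: abs_mult)
      also have "(2 * K) * (?t i - ?t j) = inner (a p) (q i) - inner (a p) (q j)"
        by (simp add: a_def algebra_simps)
      finally show ?thesis .
    qed
    show "(\<lambda>p. inner (a p) (q i)) \<in> borel_measurable (param_law \<pi>)" for i
      by measurable
  qed (simp_all add: Z_def q)
  \<comment> \<open>Unbiasedness identifies the abstract mean with the increments of the target
    function.\<close>
  have mean: "mean i = f (q i) - f 0" for i
    unfolding mean_def Z_def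
    by (simp add: integrable_neuron[OF \<pi> f] expectation_neuron[OF \<pi> f])
  have as: "(\<integral>\<^sup>+p. ennreal ((norm (a p))\<^sup>2) \<partial>param_law \<pi>) \<le> ennreal s"
  proof -
    have "(\<integral>\<^sup>+p. ennreal ((norm (a p))\<^sup>2) \<partial>param_law \<pi>)
        = (\<integral>\<^sup>+\<xi>. ennreal (\<pi> \<xi>) * ((ennreal ((norm (a (\<xi>, 0)))\<^sup>2) + ennreal ((norm (a (\<xi>, 1)))\<^sup>2)) / 2) \<partial>lborel)"
      unfolding a_def by (rule nn_integral_param_law[OF \<pi>]) measurable
    \<comment> \<open>\<open>a\<close> ignores the coin, so both coin values contribute the same
      amount.\<close>
    also have "\<dots> = (\<integral>\<^sup>+\<xi>. ennreal ((4 * pi * K)\<^sup>2 * ((norm \<xi>)\<^sup>2 * \<pi> \<xi>)) \<partial>lborel)"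
    proof (rule nn_integral_cong)
      fix \<xi> :: "real^'d"
      have "(x + x) / 2 = x" for x :: ennreal
        using half_double[of x] by (simp add: divide_ennreal_def mult.commute)
      then show "ennreal (\<pi> \<xi>) * ((ennreal ((norm (a (\<xi>, 0)))\<^sup>2) + ennreal ((norm (a (\<xi>, 1)))\<^sup>2)) / 2)
          = ennreal ((4 * pi * K)\<^sup>2 * ((norm \<xi>)\<^sup>2 * \<pi> \<xi>))"
        using pos[of \<xi>] by (simp add: a_def power_mult_distrib mult_ac flip: ennreal_mult)
    qed
    also have "\<dots> = ennreal (LINT \<xi>|lborel. (4 * pi * K)\<^sup>2 * ((norm \<xi>)\<^sup>2 * \<pi> \<xi>))"
      using pos by (intro nn_integral_eq_integral integrable_mult_right \<pi>2) auto
    also have "(LINT \<xi>|lborel. (4 * pi * K)\<^sup>2 * ((norm \<xi>)\<^sup>2 * \<pi> \<xi>)) = s"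
      unfolding s_def \<sigma>2_def by (rule integral_mult_right_zero)
    finally show ?thesis by simp
  qed
  interpret PI: prob_space "PiM I (\<lambda>_. param_law \<pi>)"
    by (intro prob_space_PiM prob_space_param_law[OF \<pi>])
  have nm [measurable]: "neuron \<pi> f x \<in> borel_measurable (param_law \<pi>)" for x
    using neuron_measurable[OF \<pi> fF] by (simp cong: measurable_cong_sets add: sets_param_law)
  \<comment> \<open>The first absolute moment at the origin is bounded by the root of the second,
    using that the modulus is the root of the square.\<close>
  have Y: "(\<integral>\<^sup>+p. ennreal \<bar>\<Sum>k\<in>I. neuron \<pi> f 0 (p k) - f 0\<bar> \<partial>PiM I (\<lambda>_. param_law \<pi>))
      \<le> ennreal (L2bar \<pi> f * sqrt (card I))"
  proof -
    have "(\<integral>\<^sup>+p. ennreal (sqrt ((\<Sum>k\<in>I. neuron \<pi> f 0 (p k) - f 0)\<^sup>2)) \<partial>PiM I (\<lambda>_. param_law \<pi>))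
        \<le> ennreal (sqrt (real (card I) * (L2bar \<pi> f)\<^sup>2))"
    proof (rule PI.nn_integral_sqrt_le)
      have "(\<integral>\<^sup>+p. ennreal ((\<Sum>k\<in>I. neuron \<pi> f 0 (p k) - f 0)\<^sup>2) \<partial>PiM I (\<lambda>_. param_law \<pi>))
          \<le> ennreal (real (card I) * expectation (\<lambda>p. (neuron \<pi> f 0 p)\<^sup>2))"
        using nn_integral_sum_square_le[OF integrable_neuron[OF \<pi> f, of 0] integrable_neuron_square[OF \<pi> f, of 0] I]
        by (simp add: expectation_neuron[OF \<pi> f])
      also have "\<dots> \<le> ennreal (real (card I) * (L2bar \<pi> f)\<^sup>2)"
        using expectation_neuron_square_le[OF \<pi> f] by (intro ennreal_leI mult_left_mono) auto
      finally show "(\<integral>\<^sup>+p. ennreal ((\<Sum>k\<in>I. neuron \<pi> f 0 (p k) - f 0)\<^sup>2) \<partial>PiM I (\<lambda>_. param_law \<pi>))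
        \<le> ennreal (real (card I) * (L2bar \<pi> f)\<^sup>2)" .
    qed auto
    then show ?thesis
      using L2 by (simp add: real_sqrt_mult mult.commute)
  qed
  have [measurable]: "(\<lambda>p. Z p i) \<in> borel_measurable (param_law \<pi>)" for i
    by (rule Z_measurable)
  have split: "(\<Sum>k\<in>I. neuron \<pi> f (q i) (p k) - f (q i))
      = (\<Sum>k\<in>I. Z (p k) i - mean i) + (\<Sum>k\<in>I. neuron \<pi> f 0 (p k) - f 0)" for p i
    by (simp add: Z_def mean flip: sum.distrib)
  have "(\<integral>\<^sup>+p. (SUP i. ennreal \<bar>\<Sum>k\<in>I. neuron \<pi> f (q i) (p k) - f (q i)\<bar>) \<partial>PiM I (\<lambda>_. param_law \<pi>))
      \<le> (\<integral>\<^sup>+p. (SUP i. ennreal \<bar>\<Sum>k\<in>I. Z (p k) i - mean i\<bar>) +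
          ennreal \<bar>\<Sum>k\<in>I. neuron \<pi> f 0 (p k) - f 0\<bar> \<partial>PiM I (\<lambda>_. param_law \<pi>))"
  proof (intro nn_integral_mono SUP_least)
    fix p i
    have "ennreal \<bar>\<Sum>k\<in>I. neuron \<pi> f (q i) (p k) - f (q i)\<bar>
        \<le> ennreal (\<bar>\<Sum>k\<in>I. Z (p k) i - mean i\<bar> + \<bar>\<Sum>k\<in>I. neuron \<pi> f 0 (p k) - f 0\<bar>)"
      unfolding split by (intro ennreal_leI abs_triangle_ineq)
    also have "\<dots> = ennreal \<bar>\<Sum>k\<in>I. Z (p k) i - mean i\<bar> + ennreal \<bar>\<Sum>k\<in>I. neuron \<pi> f 0 (p k) - f 0\<bar>"
      by simp
    also have "\<dots> \<le> (SUP i. ennreal \<bar>\<Sum>k\<in>I. Z (p k) i - mean i\<bar>) +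
          ennreal \<bar>\<Sum>k\<in>I. neuron \<pi> f 0 (p k) - f 0\<bar>"
      by (intro add_right_mono SUP_upper) simp
    finally show "ennreal \<bar>\<Sum>k\<in>I. neuron \<pi> f (q i) (p k) - f (q i)\<bar>
        \<le> (SUP i. ennreal \<bar>\<Sum>k\<in>I. Z (p k) i - mean i\<bar>) +
          ennreal \<bar>\<Sum>k\<in>I. neuron \<pi> f 0 (p k) - f 0\<bar>" .
  qed
  also have "\<dots> = (\<integral>\<^sup>+p. (SUP i. ennreal \<bar>\<Sum>k\<in>I. Z (p k) i - mean i\<bar>) \<partial>PiM I (\<lambda>_. param_law \<pi>)) +
      (\<integral>\<^sup>+p. ennreal \<bar>\<Sum>k\<in>I. neuron \<pi> f 0 (p k) - f 0\<bar> \<partial>PiM I (\<lambda>_. param_law \<pi>))"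
    by (rule nn_integral_add) measurable
  also have "\<dots> \<le> ennreal (4 * r * sqrt (real (card I) * s)) + ennreal (L2bar \<pi> f * sqrt (card I))"
    by (intro add_mono nn_integral_SUP_abs_le[OF refl a_meas q(2) as s I] Y)
  also have "\<dots> = ennreal (4 * r * sqrt (real (card I) * s) + L2bar \<pi> f * sqrt (card I))"
    using r s L2 by simp
  also have "4 * r * sqrt (real (card I) * s) = 16 * pi * K * r * sqrt \<sigma>2 * sqrt (card I)"
    using K by (simp add: s_def real_sqrt_mult mult_ac)
  finally show ?thesis by (simp add: K_def \<sigma>2_def)
qed

theorem mainTheorem6:
  fixes P :: "'w measure"
    and \<pi> f :: "real^'d::{finite,linorder} \<Rightarrow> real"
    and M :: real and n :: nat
    and A :: "nat \<Rightarrow> 'w \<Rightarrow> real^'d::{finite,linorder}" and B :: "nat \<Rightarrow> 'w \<Rightarrow> real"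
    and V :: "complex mat"
  assumes "prob_density \<pi>"
    and "integrable lborel (\<lambda>\<xi>. (norm \<xi>)\<^sup>2 * \<pi> \<xi>)"
    and "M > 0"
    and "f \<in> class_Fb \<pi>"
    and "n \<ge> 1"
    and "prob_space P"
    and "random_params P n \<pi> A B"
    and "is_Vbar n V"
  shows "\<exists>W \<in> measurable (sigma_AB P n A B) (PiM {..<n} (\<lambda>_. borel :: real measure)).
    (\<lambda>\<omega>. sup_error n V (\<lambda>i. A i \<omega>) (\<lambda>i. B i \<omega>) (W \<omega>) f M) \<in> borel_measurable P \<and>
    (\<integral>\<^sup>+ \<omega>. sup_error n V (\<lambda>i. A i \<omega>) (\<lambda>i. B i \<omega>) (W \<omega>) f M \<partial>P) \<le>
      ennreal (1 / sqrt (real n) *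
        (8 * ratio_sup_norm \<pi> f *
           (pi / 2 powr (3/2) +
            2 * pi * M * sqrt (real CARD('d)) * sqrt (LINT \<xi>|lborel. (norm \<xi>)\<^sup>2 * \<pi> \<xi>))
         + L2bar \<pi> f))"
proof -
  note \<pi> = assms(1) and f = assms(4) and n = assms(5) and P = assms(6) and rp = assms(7) and V = assms(8)
  let ?I = "{1..n}" and ?S = "{x :: real^'d::{finite,linorder}. \<forall>j. vec_nth x j \<in> {-M..M}}"
  define K \<sigma> where "K = ratio_sup_norm \<pi> f" and "\<sigma> = sqrt (LINT \<xi>|lborel. (norm \<xi>)\<^sup>2 * \<pi> \<xi>)"
  have fF: "f \<in> class_F \<pi>" using f by (simp add: class_Fb_def)
  then have cf: "continuous_on UNIV f" by (simp add: class_F_def)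
  obtain q :: "nat \<Rightarrow> real^'d::{finite,linorder}" where q0: "q 0 = 0" and q: "range q \<subseteq> ?S" "?S \<subseteq> closure (range q)"
    using cube_dense_sequence[OF assms(3)] by blast
  \<comment> \<open>Going through \<open>family_of\<close> makes \<open>W\<close> a function of the
    very map that generates \<open>sigma_AB\<close>. Weights are indexed from 0 and parameters from
    1, hence \<open>Suc j\<close>.\<close>
  define W where "W \<omega> = (\<lambda>j\<in>{..<n}. weight \<pi> f (family_of n A \<omega> (Suc j), family_of n B \<omega> (Suc j)))" for \<omega>
  define p where "p \<omega> = (\<lambda>k\<in>?I. (A k \<omega>, B k \<omega>))" for \<omega>
  define G where "G z = (SUP i. ennreal \<bar>\<Sum>k\<in>?I. neuron \<pi> f (q i) (z k) - f (q i)\<bar>)" for z :: "nat \<Rightarrow> (real^'d::{finite,linorder}) \<times> real"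
  have W_meas: "W \<in> measurable (sigma_AB P n A B) (PiM {..<n} (\<lambda>_. borel :: real measure))"
  proof -
    let ?N = "PiM ?I (\<lambda>_. borel :: (real^'d::{finite,linorder}) measure) \<Otimes>\<^sub>M PiM ?I (\<lambda>_. borel :: real measure)"
    have 1: "(\<lambda>\<omega>. (family_of n A \<omega>, family_of n B \<omega>)) \<in> sigma_AB P n A B \<rightarrow>\<^sub>M ?N"
      unfolding sigma_AB_def
      by (rule measurable_vimage_algebra1) (auto simp: space_pair_measure space_PiM family_of_def)
    have 2: "(\<lambda>z. \<lambda>j\<in>{..<n}. weight \<pi> f (fst z (Suc j), snd z (Suc j))) \<in> ?N \<rightarrow>\<^sub>M PiM {..<n} (\<lambda>_. borel)"
    proof (rule measurable_restrict)
      fix j assume "j \<in> {..<n}"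
      then have j: "Suc j \<in> ?I" by auto
      have [measurable]: "(\<lambda>z. fst z (Suc j)) \<in> ?N \<rightarrow>\<^sub>M borel" "(\<lambda>z. snd z (Suc j)) \<in> ?N \<rightarrow>\<^sub>M borel"
        by (rule measurable_compose[OF measurable_fst measurable_component_singleton[OF j]]
            measurable_compose[OF measurable_snd measurable_component_singleton[OF j]])+
      note [measurable] = weight_measurable[OF \<pi> fF]
      show "(\<lambda>z. weight \<pi> f (fst z (Suc j), snd z (Suc j))) \<in> borel_measurable ?N"
        by measurable
    qed
    from measurable_compose[OF 1 2] show ?thesis
      by (simp add: W_def[abs_def])
  qed
  \<comment> \<open>The error depends on the sample only through the parameter pairs
    \<open>p\<close>; this gives its measurability and lets the expectation be computed under the
    product law.\<close>
  have err: "sup_error n V (\<lambda>i. A i \<omega>) (\<lambda>i. B i \<omega>) (W \<omega>) f M = ennreal (1 / n) * G (p \<omega>)" for \<omega>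
  proof -
    have F: "qrnn n V (\<lambda>i. A i \<omega>) (\<lambda>i. B i \<omega>) (W \<omega>) x - f x
        = (1 / n) * (\<Sum>k\<in>?I. neuron \<pi> f x (p \<omega> k) - f x)" for x
    proof -
      have "(\<Sum>j<n. W \<omega> j * cos (2 * pi * inner (A (Suc j) \<omega>) x + pi / 2 * B (Suc j) \<omega>))
          = (\<Sum>j<n. neuron \<pi> f x (p \<omega> (Suc j)))"
        by (intro sum.cong) (auto simp: W_def neuron_def p_def family_of_def)
      also have "\<dots> = (\<Sum>k\<in>?I. neuron \<pi> f x (p \<omega> k))"
        using sum.shift_bounds_Suc_ivl[of "\<lambda>k. neuron \<pi> f x (p \<omega> k)" 0 n]
        by (simp add: atLeast0LessThan atLeastLessThanSuc_atLeastAtMost)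
      finally have "qrnn n V (\<lambda>i. A i \<omega>) (\<lambda>i. B i \<omega>) (W \<omega>) x = (\<Sum>k\<in>?I. neuron \<pi> f x (p \<omega> k)) / n"
        by (simp add: qrnn_eq[OF V])
      then show ?thesis using n by (simp add: sum_subtractf field_simps)
    qed
    have "continuous_on UNIV (\<lambda>x. qrnn n V (\<lambda>i. A i \<omega>) (\<lambda>i. B i \<omega>) (W \<omega>) x - f x)"
      unfolding qrnn_eq[OF V] using cf n by (intro continuous_intros) auto
    from SUP_ennreal_dense[OF this q]
    have "sup_error n V (\<lambda>i. A i \<omega>) (\<lambda>i. B i \<omega>) (W \<omega>) f M
        = (SUP i. ennreal \<bar>(1 / n) * (\<Sum>k\<in>?I. neuron \<pi> f (q i) (p \<omega> k) - f (q i))\<bar>)"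
      unfolding sup_error_def F .
    also have "\<dots> = (SUP i. ennreal (1 / n) * ennreal \<bar>\<Sum>k\<in>?I. neuron \<pi> f (q i) (p \<omega> k) - f (q i)\<bar>)"
      unfolding abs_mult by (subst ennreal_mult') simp_all
    also have "\<dots> = ennreal (1 / n) * G (p \<omega>)"
      unfolding G_def by (rule SUP_mult_left_ennreal[symmetric])
    finally show ?thesis .
  qed
  have G_meas [measurable]: "G \<in> borel_measurable (PiM ?I (\<lambda>_. borel \<Otimes>\<^sub>M borel))"
  proof -
    note [measurable] = neuron_measurable[OF \<pi> fF]
    show ?thesis unfolding G_def[abs_def] by measurable
  qed
  have p_meas [measurable]: "p \<in> P \<rightarrow>\<^sub>M PiM ?I (\<lambda>_. borel \<Otimes>\<^sub>M borel)"
    unfolding p_def[abs_def]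
    by (intro measurable_restrict measurable_Pair random_params_distr[OF P \<pi> rp n])
  have r: "norm (q i) \<le> M * sqrt (real CARD('d))" for i
    using q(1) by (intro norm_le_cube) blast
  have K: "0 \<le> K" using ratio_sup_norm_nonneg[OF f] by (simp add: K_def)
  have "(\<integral>\<^sup>+ \<omega>. sup_error n V (\<lambda>i. A i \<omega>) (\<lambda>i. B i \<omega>) (W \<omega>) f M \<partial>P) = ennreal (1 / n) * (\<integral>\<^sup>+\<omega>. G (p \<omega>) \<partial>P)"
    unfolding err by (rule nn_integral_cmult) measurable
  also have "(\<integral>\<^sup>+\<omega>. G (p \<omega>) \<partial>P) = (\<integral>\<^sup>+z. G z \<partial>PiM ?I (\<lambda>_. param_law \<pi>))"
    unfolding random_params_distr(3)[OF P \<pi> rp n, symmetric] p_def[symmetric, abs_def]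
    by (rule nn_integral_distr[symmetric]) measurable
  also have "ennreal (1 / n) * \<dots>
      \<le> ennreal (1 / n) * ennreal (16 * pi * K * (M * sqrt (real CARD('d))) * \<sigma> * sqrt (card ?I) + L2bar \<pi> f * sqrt (card ?I))"
    unfolding G_def K_def \<sigma>_def
    by (intro mult_left_mono nn_integral_sup_neuron_deviation_le \<pi> assms(2) f q0 r) simp_all
  also have "16 * pi * K * (M * sqrt (real CARD('d))) * \<sigma> * sqrt (card ?I) + L2bar \<pi> f * sqrt (card ?I)
      = sqrt n * (16 * pi * K * (M * sqrt (real CARD('d))) * \<sigma> + L2bar \<pi> f)"
    by (simp add: algebra_simps)
  also have "ennreal (1 / n) * ennreal \<dots> = ennreal (1 / n * (sqrt n * (16 * pi * K * (M * sqrt (real CARD('d))) * \<sigma> + L2bar \<pi> f)))"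
    by (rule ennreal_mult'[symmetric]) simp
  also have "\<dots> = ennreal (1 / sqrt n * (16 * pi * K * (M * sqrt (real CARD('d))) * \<sigma> + L2bar \<pi> f))"
  proof -
    have "1 / real n * sqrt n = 1 / sqrt n"
      using n by (simp add: field_simps)
    then show ?thesis by (simp only: mult.assoc[symmetric])
  qed
  also have "\<dots> \<le> ennreal (1 / sqrt n * (8 * K * (pi / 2 powr (3/2) + 2 * pi * M * sqrt (real CARD('d)) * \<sigma>) + L2bar \<pi> f))"
  proof (intro ennreal_leI mult_left_mono add_right_mono)
    have "16 * pi * K * (M * sqrt (real CARD('d))) * \<sigma> = 8 * K * (2 * pi * M * sqrt (real CARD('d)) * \<sigma>)"
      by simp
    also have "\<dots> \<le> 8 * K * (pi / 2 powr (3/2) + 2 * pi * M * sqrt (real CARD('d)) * \<sigma>)"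
      using K by (intro mult_left_mono) auto
    finally show "16 * pi * K * (M * sqrt (real CARD('d))) * \<sigma>
        \<le> 8 * K * (pi / 2 powr (3/2) + 2 * pi * M * sqrt (real CARD('d)) * \<sigma>)" .
  qed simp
  finally have bound: "(\<integral>\<^sup>+ \<omega>. sup_error n V (\<lambda>i. A i \<omega>) (\<lambda>i. B i \<omega>) (W \<omega>) f M \<partial>P)
      \<le> ennreal (1 / sqrt n * (8 * K * (pi / 2 powr (3/2) + 2 * pi * M * sqrt (real CARD('d)) * \<sigma>) + L2bar \<pi> f))" .
  moreover have "(\<lambda>\<omega>. sup_error n V (\<lambda>i. A i \<omega>) (\<lambda>i. B i \<omega>) (W \<omega>) f M) \<in> borel_measurable P"
    unfolding err by measurable
  ultimately show ?thesis
    using W_meas unfolding K_def \<sigma>_def by blast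
qed

end
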